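(* Let $G=G_e$ be the group of elliptic rotations acting diagonally on $\mathbb R^6$, and put $\sigma_1=x_3$, $\sigma_2=y_3$, $\sigma_3=y_1^2+y_2^2-y_3^2$, $\sigma_6=x_1y_2-x_2y_1$. (a) The $G$-orbit of $(0,0,1,0,0,0)^{\rm tr}$ consists of this point only. The orbit of every other point of $T\mathbb H^2$ is an ellipse which lies in a two-dimensional affine subspace of $\mathbb R^6$. (b) The map $\Gamma:V\to\mathbb R^4$, $z\mapsto w=(w_1,w_2,w_3,w_4)^{\rm tr}=(\sigma_1(z),\sigma_2(z),\sigma_3(z),\sigma_6(z))^{\rm tr}$, sends $V$ to the variety $Y\subseteq\mathbb R^4$ defined by $$w_4^2=(w_1^2-1)w_3-w_2^2 .$$ (c) The image of $T\mathbb H^2$ under $\Gamma$ is the union of $$\{w\in Y:\ w_1>1\text{ and }w_2^2+w_3>0\}$$ and $$\{(1,0,w_3,0)^{\rm tr}:\ w_3\ge 0\}\cup\{(w_1,0,0,0)^{\rm tr}:\ w_1\ge 1\}.$$ In particular $\Gamma(V)$ is Zariski-dense in $Y$. (d) The Dirac-Poisson bracket $\{\cdot,\cdot\}^*$ on $V$ induces a Poisson bracket $\{\cdot,\cdot\}'$ on $Y$, which is determined by $$\{w_1,w_2\}'=-1+w_1^2,\quad \{w_2,w_3\}'=2w_1w_3,\quad \{w_3,w_1\}'=-2w_2,$$ and $\{w_i,w_4\}'=0$ for $1\le i\le 3$. (e) For the Hamiltonian $H=\frac12\sigma_3+U(\sigma_1)$ with axisymmetric potential $U=U(x_3)$, $U$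 a polynomial or rational function, the equations of motion on $T\mathbb H^2$, $$\dot x=y,\qquad \dot y=-\nabla_L^xU+x\left(\langle y,y\rangle_L-\langle x,\nabla_L^xU\rangle_L\right),$$ are mapped by $\Gamma$ to the reduced Hamiltonian system $$\dot w_1=\{w_1,h\}'=w_2,\quad \dot w_2=\{w_2,h\}'=w_1w_3+(1-w_1^2)U'(w_1),$$ $$\dot w_3=\{w_3,h\}'=-2w_2U'(w_1),\quad \dot w_4=\{w_4,h\}'=0$$ on $Y$, with $h(w):=\frac12w_3+U(w_1)$. This system admits the first integrals $h$ and $w_4$.
   Context: Coordinates on $\mathbb R^6$ (identified with the tangent bundle $T\mathbb R^{2,1}$ of Minkowski space) are $(x,y)=(x_1,x_2,x_3,y_1,y_2,y_3)$. The Lorentz pseudo inner product is $\langle u,v\rangle_L=u_1v_1+u_2v_2-u_3v_3$, and $\nabla_L^xf=(\partial f/\partial x_1,\partial f/\partial x_2,-\partial f/\partial x_3)^{\rm tr}$. Put $$V=\{(x,y)\in\mathbb R^6:\langle x,x\rangle_L+1=0,\ \langle x,y\rangle_L=0\},\qquad T\mathbb H^2=\{(x,y)\in V: x_3>0\}.$$ For $A\in GL(3,\mathbb R)$ the diagonal action on $\mathbb R^6$ is $(x,y)\mapsto(Ax,Ay)$. The group $G_e$ of elliptic rotations consists of the matrices $\begin{pmatrix}\cos\theta&-\sin\theta&0\\ \sin\theta&\cos\theta&0\\0&0&1\end{pmatrix}$, $\theta\in[0,2\pi)$. For a real variety $Z$, $\mathbb R[Z]$ is the algebra of restrictions of polynomials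 to $Z$; a Poisson bracket on $Z$ is a skew-symmetric bilinear map $\mathbb R[Z]\times\mathbb R[Z]\to\mathbb R[Z]$ satisfying the Leibniz rule and the Jacobi identity. The Dirac-Poisson bracket $\{\cdot,\cdot\}^*$ on $V$ is the Poisson bracket determined by $\{x_i,x_j\}^*=0$, $\{x_i,y_j\}^*=g_{ij}+x_ix_j$, $\{y_i,y_j\}^*=x_iy_j-x_jy_i$, where $(g_{ij})={\rm diag}(1,1,-1)$. That it "induces" a bracket $\{\cdot,\cdot\}'$ on $Y$ means that $\{\cdot,\cdot\}'$ is a Poisson bracket on $Y$ with $\{\phi\circ\Gamma,\psi\circ\Gamma\}^*=\{\phi,\psi\}'\circ\Gamma$ for all $\phi,\psi\in\mathbb R[Y]$. For rational (or smooth) $h$ the bracket $\{w_i,h\}'=\sum_j\{w_i,w_j\}'\,\partial h/\partial w_j$ is used where $h$ is defined. "Mapped by $\Gamma$" means that $\Gamma$ maps parameterized solutions to parameterized solutions. *)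

theory Defs
  imports "HOL-Analysis.Analysis"
begin

text \<open>
  \<open>\<real>\<^sup>6\<close> is represented as \<open>(real^3) \<times> (real^3)\<close> with points \<open>z = (x, y)\<close>.
\<close>

definition lor :: "real^3 \<Rightarrow> real^3 \<Rightarrow> real" where
  "lor u v = u$1 * v$1 + u$2 * v$2 - u$3 * v$3"

definition gmat :: "3 \<Rightarrow> 3 \<Rightarrow> real" where
  "gmat i j = (if i = j then (if i = 3 then -1 else 1) else 0)"

definition partial_at :: "(real^3 \<Rightarrow> real) \<Rightarrow> 3 \<Rightarrow> real^3 \<Rightarrow> real" where
  "partial_at f i x = frechet_derivative f (at x) (axis i 1)"

definition nabla_lor :: "(real^3 \<Rightarrow> real) \<Rightarrow> real^3 \<Rightarrow> real^3" where
  "nabla_lor f x = vector [partial_at f 1 x, partial_at f 2 x, - partial_at f 3 x]"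

definition Vvar :: "((real^3) \<times> (real^3)) set" where
  "Vvar = {(x, y). lor x x + 1 = 0 \<and> lor x y = 0}"

definition TH2 :: "((real^3) \<times> (real^3)) set" where
  "TH2 = {(x, y). (x, y) \<in> Vvar \<and> x$3 > 0}"

definition ell_rot :: "real \<Rightarrow> real^3^3" where
  "ell_rot \<theta> = vector [vector [cos \<theta>, - sin \<theta>, 0],
                       vector [sin \<theta>, cos \<theta>, 0],
                       vector [0, 0, 1]]"

definition G_e :: "(real^3^3) set" where
  "G_e = ell_rot ` {0..<2*pi}"

definition diag_act :: "real^3^3 \<Rightarrow> (real^3) \<times> (real^3) \<Rightarrow> (real^3) \<times> (real^3)" where
  "diag_act A z = (A *v fst z, A *v snd z)"

definition orbit_of :: "(real^3^3) set \<Rightarrow> (real^3) \<times> (real^3) \<Rightarrow> ((real^3) \<times> (real^3)) set" where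
  "orbit_of G z = {diag_act A z | A. A \<in> G}"

text \<open>Nondegenerate ellipse with centre \<open>c\<close> and orthogonal semi-axes \<open>a\<close>, \<open>b\<close>; circles are included.\<close>

definition is_ellipse :: "'a::real_inner set \<Rightarrow> bool" where
  "is_ellipse E \<longleftrightarrow> (\<exists>c a b. a \<noteq> 0 \<and> b \<noteq> 0 \<and> a \<bullet> b = 0 \<and>
     E = range (\<lambda>t::real. c + cos t *\<^sub>R a + sin t *\<^sub>R b))"

text \<open>
  Elements of \<open>\<real>[Z]\<close> are functions on \<open>Z\<close>, represented extensionally (value \<^const>\<open>undefined\<close>
  outside \<open>Z\<close>), so that polynomials agreeing on \<open>Z\<close> give equal elements.
\<close>

definition coord_ring :: "'a::euclidean_space set \<Rightarrow> ('a \<Rightarrow> real) set" where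
  "coord_ring Z = {restrict p Z | p. real_polynomial_function p}"

definition zariski_closed :: "'a::euclidean_space set \<Rightarrow> bool" where
  "zariski_closed C \<longleftrightarrow>
     (\<exists>P. (\<forall>p\<in>P. real_polynomial_function p) \<and> C = {z. \<forall>p\<in>P. p z = 0})"

definition zariski_dense_in :: "'a::euclidean_space set \<Rightarrow> 'a set \<Rightarrow> bool" where
  "zariski_dense_in S Z \<longleftrightarrow> S \<subseteq> Z \<and> (\<forall>C. zariski_closed C \<and> S \<subseteq> C \<longrightarrow> Z \<subseteq> C)"

text \<open>
  The extensional function space makes a bracket on \<open>Z\<close> the same thing as a map
  \<open>\<real>[Z] \<times> \<real>[Z] \<rightarrow> \<real>[Z]\<close>, so uniqueness of brackets can be expressed by HOL equality.
  Linearity and the Leibniz rule in the second argument follow from skew-symmetry.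
\<close>

definition poisson_bracket_on ::
  "'a::euclidean_space set \<Rightarrow> (('a \<Rightarrow> real) \<Rightarrow> ('a \<Rightarrow> real) \<Rightarrow> ('a \<Rightarrow> real)) \<Rightarrow> bool" where
  "poisson_bracket_on Z B \<longleftrightarrow>
     B \<in> coord_ring Z \<rightarrow>\<^sub>E (coord_ring Z \<rightarrow>\<^sub>E coord_ring Z) \<and>
     (\<forall>f\<in>coord_ring Z. \<forall>g\<in>coord_ring Z. \<forall>z\<in>Z. B f g z = - B g f z) \<and>
     (\<forall>f\<in>coord_ring Z. \<forall>g\<in>coord_ring Z. \<forall>k\<in>coord_ring Z. \<forall>a b. \<forall>z\<in>Z.
        B (\<lambda>z\<in>Z. a * f z + b * g z) k z = a * B f k z + b * B g k z) \<and>
     (\<forall>f\<in>coord_ring Z. \<forall>g\<in>coord_ring Z. \<forall>k\<in>coord_ring Z. \<forall>z\<in>Z.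
        B (\<lambda>z\<in>Z. f z * g z) k z = f z * B g k z + B f k z * g z) \<and>
     (\<forall>f\<in>coord_ring Z. \<forall>g\<in>coord_ring Z. \<forall>k\<in>coord_ring Z. \<forall>z\<in>Z.
        B f (B g k) z + B g (B k f) z + B k (B f g) z = 0)"

definition is_dirac_poisson_bracket ::
  "(((real^3) \<times> (real^3) \<Rightarrow> real) \<Rightarrow> ((real^3) \<times> (real^3) \<Rightarrow> real) \<Rightarrow> ((real^3) \<times> (real^3) \<Rightarrow> real)) \<Rightarrow> bool"
where
  "is_dirac_poisson_bracket B \<longleftrightarrow>
     poisson_bracket_on Vvar B \<and>
     (\<forall>i j.
        B (\<lambda>z\<in>Vvar. fst z $ i) (\<lambda>z\<in>Vvar. fst z $ j) = (\<lambda>z\<in>Vvar. 0) \<and>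
        B (\<lambda>z\<in>Vvar. fst z $ i) (\<lambda>z\<in>Vvar. snd z $ j)
          = (\<lambda>z\<in>Vvar. gmat i j + fst z $ i * fst z $ j) \<and>
        B (\<lambda>z\<in>Vvar. snd z $ i) (\<lambda>z\<in>Vvar. snd z $ j)
          = (\<lambda>z\<in>Vvar. fst z $ i * snd z $ j - fst z $ j * snd z $ i))"

definition dirac_poisson_bracket ::
  "((real^3) \<times> (real^3) \<Rightarrow> real) \<Rightarrow> ((real^3) \<times> (real^3) \<Rightarrow> real) \<Rightarrow> ((real^3) \<times> (real^3) \<Rightarrow> real)"
where
  "dirac_poisson_bracket = (THE B. is_dirac_poisson_bracket B)"

definition induces_bracket ::
  "'a::euclidean_space set \<Rightarrow> (('a \<Rightarrow> real) \<Rightarrow> ('a \<Rightarrow> real) \<Rightarrow> ('a \<Rightarrow> real)) \<Rightarrow> ('a \<Rightarrow> 'b) \<Rightarrow>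
   'b::euclidean_space set \<Rightarrow> (('b \<Rightarrow> real) \<Rightarrow> ('b \<Rightarrow> real) \<Rightarrow> ('b \<Rightarrow> real)) \<Rightarrow> bool" where
  "induces_bracket Z B \<Gamma> W B' \<longleftrightarrow>
     poisson_bracket_on W B' \<and>
     (\<forall>\<phi>\<in>coord_ring W. \<forall>\<psi>\<in>coord_ring W.
        B (compose Z \<phi> \<Gamma>) (compose Z \<psi> \<Gamma>) = compose Z (B' \<phi> \<psi>) \<Gamma>)"

text \<open>
  \<open>{f, h} = \<Sum>\<^sub>j {f, z\<^sub>j} \<partial>h/\<partial>z\<^sub>j\<close> for polynomial \<open>f\<close> and merely differentiable (e.g. rational) \<open>h\<close>,
  followed by the resulting Hamiltonian vector field \<open>{z\<^sub>i, h}\<close>.  Both are meaningful only at points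
  of \<open>Z\<close> where \<open>h\<close> is differentiable.
\<close>

definition bracket_ext ::
  "'a::euclidean_space set \<Rightarrow> (('a \<Rightarrow> real) \<Rightarrow> ('a \<Rightarrow> real) \<Rightarrow> ('a \<Rightarrow> real)) \<Rightarrow>
   ('a \<Rightarrow> real) \<Rightarrow> ('a \<Rightarrow> real) \<Rightarrow> 'a \<Rightarrow> real" where
  "bracket_ext Z B f h z =
     (\<Sum>j\<in>Basis. B (restrict f Z) (\<lambda>u\<in>Z. u \<bullet> j) z * frechet_derivative h (at z) j)"

definition hamiltonian_field ::
  "'a::euclidean_space set \<Rightarrow> (('a \<Rightarrow> real) \<Rightarrow> ('a \<Rightarrow> real) \<Rightarrow> ('a \<Rightarrow> real)) \<Rightarrow>
   ('a \<Rightarrow> real) \<Rightarrow> 'a \<Rightarrow> 'a" where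
  "hamiltonian_field Z B h z = (\<Sum>i\<in>Basis. bracket_ext Z B (\<lambda>u. u \<bullet> i) h z *\<^sub>R i)"

definition solution_on ::
  "('a::real_normed_vector \<Rightarrow> 'a) \<Rightarrow> 'a set \<Rightarrow> real set \<Rightarrow> (real \<Rightarrow> 'a) \<Rightarrow> bool" where
  "solution_on F D I z \<longleftrightarrow> open I \<and> is_interval I \<and>
     (\<forall>t\<in>I. z t \<in> D \<and> (z has_vector_derivative F (z t)) (at t))"

definition first_integral_on ::
  "('a::real_normed_vector \<Rightarrow> 'a) \<Rightarrow> 'a set \<Rightarrow> ('a \<Rightarrow> real) \<Rightarrow> bool" where
  "first_integral_on F D \<phi> \<longleftrightarrow>
     (\<forall>I z. solution_on F D I z \<longrightarrow> (\<forall>s\<in>I. \<forall>t\<in>I. \<phi> (z s) = \<phi> (z t)))"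

definition sigma1 :: "(real^3) \<times> (real^3) \<Rightarrow> real" where
  "sigma1 z = fst z $ 3"

definition sigma2 :: "(real^3) \<times> (real^3) \<Rightarrow> real" where
  "sigma2 z = snd z $ 3"

definition sigma3 :: "(real^3) \<times> (real^3) \<Rightarrow> real" where
  "sigma3 z = (snd z $ 1)^2 + (snd z $ 2)^2 - (snd z $ 3)^2"

definition sigma6 :: "(real^3) \<times> (real^3) \<Rightarrow> real" where
  "sigma6 z = fst z $ 1 * snd z $ 2 - fst z $ 2 * snd z $ 1"

definition Gam :: "(real^3) \<times> (real^3) \<Rightarrow> real^4" where
  "Gam z = vector [sigma1 z, sigma2 z, sigma3 z, sigma6 z]"

definition Yvar :: "(real^4) set" where
  "Yvar = {w. (w$4)^2 = ((w$1)^2 - 1) * w$3 - (w$2)^2}"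

definition reduced_relations ::
  "((real^4 \<Rightarrow> real) \<Rightarrow> (real^4 \<Rightarrow> real) \<Rightarrow> (real^4 \<Rightarrow> real)) \<Rightarrow> bool" where
  "reduced_relations B \<longleftrightarrow>
     B (\<lambda>w\<in>Yvar. w$1) (\<lambda>w\<in>Yvar. w$2) = (\<lambda>w\<in>Yvar. -1 + (w$1)^2) \<and>
     B (\<lambda>w\<in>Yvar. w$2) (\<lambda>w\<in>Yvar. w$3) = (\<lambda>w\<in>Yvar. 2 * w$1 * w$3) \<and>
     B (\<lambda>w\<in>Yvar. w$3) (\<lambda>w\<in>Yvar. w$1) = (\<lambda>w\<in>Yvar. - 2 * w$2) \<and>
     (\<forall>i\<in>{1,2,3}. B (\<lambda>w\<in>Yvar. w$i) (\<lambda>w\<in>Yvar. w$4) = (\<lambda>w\<in>Yvar. 0))"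

definition motion_field ::
  "(real^3 \<Rightarrow> real) \<Rightarrow> (real^3) \<times> (real^3) \<Rightarrow> (real^3) \<times> (real^3)" where
  "motion_field u = (\<lambda>(x, y).
     (y, - nabla_lor u x + (lor y y - lor x (nabla_lor u x)) *\<^sub>R x))"

end

theory Submission
  imports Defs
begin

text \<open>
  Both brackets come from polynomial bivector fields on the ambient spaces \<open>\<real>\<^sup>6\<close> and \<open>\<real>\<^sup>4\<close>, where the
  Jacobi identity holds identically; it has to be verified on coordinates only, because the Jacobi
  sum is a derivation in each argument (\<open>jacobiator_eq_0\<close>). Such a bivector field descends to the
  coordinate ring of a variety if Hamiltonian vectors annihilate the vanishing ideal
  (locale \<open>poisson_variety\<close>). A bracket is determined by its values on coordinates
  (\<open>poisson_bracket_on_eqI\<close>), which gives both uniqueness claims.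

  On \<open>Vvar\<close>, which is smooth, the ideal condition follows from tangency: each tangent vector is the
  velocity of a curve in \<open>Vvar\<close> (\<open>Vvar_tangent_curve\<close>). On the singular variety \<open>Yvar\<close> it is transported
  from \<open>Vvar\<close> by two facts. First, the derivative of \<open>Gam\<close> intertwines the two bivector fields along
  \<open>Vvar\<close> (\<open>Gam_poisson\<close>). Second, a polynomial that vanishes on the image of \<open>Gam\<close> vanishes on \<open>Yvar\<close>
  (\<open>vanish_on_Yvar\<close>), because every point of \<open>Yvar\<close> is joined to the part \<open>w\<^sub>1 > 1\<close>, or to a ray in the
  image, by a polynomial curve. An explicit section of \<open>Gam\<close> over \<open>w\<^sub>1 > 1\<close> (\<open>section_over_Yvar\<close>) serves
  both this density and the description of the image of \<open>TH2\<close>.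

  The same intertwining property maps the Hamiltonian vector field of \<open>h \<circ> Gam\<close> to that of \<open>h\<close>, so
  the equations of motion reduce once they are recognized as the Hamiltonian field of
  \<open>H = h \<circ> Gam\<close>. Conservation of \<open>h\<close> is skew symmetry, and \<open>w\<^sub>4\<close> is a Casimir function. The orbits are
  ellipses by inspection of the rotation matrix; the two axes vanish only at the vertex of the
  hyperboloid with zero velocity.

  In names of lemmas, \<open>rpf\<close> stands for \<open>real_polynomial_function\<close>.
\<close>

section \<open>Gradients\<close>

definition gradient :: "('a::euclidean_space \<Rightarrow> real) \<Rightarrow> 'a \<Rightarrow> 'a" where
  "gradient f z = (\<Sum>i\<in>Basis. frechet_derivative f (at z) i *\<^sub>R i)"

lemma has_derivative_gradient:
  assumes "f differentiable at z"
  shows "(f has_derivative (\<lambda>v. gradient f z \<bullet> v)) (at z)"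
proof -
  let ?D = "frechet_derivative f (at z)"
  have D: "(f has_derivative ?D) (at z)"
    using assms by (simp add: frechet_derivative_works)
  then have l: "linear ?D"
    by (rule has_derivative_linear)
  have "?D v = gradient f z \<bullet> v" for v
  proof -
    have "?D v = ?D (\<Sum>i\<in>Basis. (v \<bullet> i) *\<^sub>R i)"
      by (simp add: euclidean_representation)
    also have "\<dots> = (\<Sum>i\<in>Basis. (v \<bullet> i) * ?D i)"
      using l by (simp add: linear_sum linear_cmul)
    also have "\<dots> = gradient f z \<bullet> v"
      by (simp add: gradient_def inner_sum_left mult.commute) (simp add: inner_commute)
    finally show ?thesis .
  qed
  then have "?D = (\<lambda>v. gradient f z \<bullet> v)" by (rule ext)
  with D show ?thesis by (rule subst[rotated])
qed

lemma gradient_eqI: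
  assumes "(f has_derivative (\<lambda>v. g \<bullet> v)) (at z)"
  shows "gradient f z = g"
proof -
  have "frechet_derivative f (at z) = (\<lambda>v. g \<bullet> v)"
    using assms by (metis frechet_derivative_at)
  then show ?thesis
    by (simp add: gradient_def euclidean_representation)
qed

lemma gradient_const [simp]: "gradient (\<lambda>z. c) z = 0"
  by (rule gradient_eqI) simp

lemma gradient_inner_left [simp]: "gradient (\<lambda>z. z \<bullet> v) z = v"
  by (rule gradient_eqI) (auto intro!: derivative_eq_intros simp: inner_commute)

lemma gradient_add:
  assumes "f differentiable at z" "g differentiable at z"
  shows "gradient (\<lambda>z. f z + g z) z = gradient f z + gradient g z"
  by (rule gradient_eqI)
    (auto intro!: derivative_eq_intros has_derivative_gradient assms simp: inner_simps)

lemma gradient_diff: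
  assumes "f differentiable at z" "g differentiable at z"
  shows "gradient (\<lambda>z. f z - g z) z = gradient f z - gradient g z"
  by (rule gradient_eqI)
    (auto intro!: derivative_eq_intros has_derivative_gradient assms simp: inner_simps)

lemma gradient_mult:
  assumes "f differentiable at z" "g differentiable at z"
  shows "gradient (\<lambda>z. f z * g z) z = f z *\<^sub>R gradient g z + g z *\<^sub>R gradient f z"
  by (rule gradient_eqI)
    (auto intro!: derivative_eq_intros has_derivative_gradient assms simp: inner_simps)

lemma gradient_chain:
  assumes "(F has_derivative F') (at z)" and "f differentiable at (F z)"
  shows "gradient (\<lambda>z. f (F z)) z \<bullet> v = gradient f (F z) \<bullet> F' v"
proof -
  have d: "((\<lambda>z. f (F z)) has_derivative (\<lambda>v. gradient f (F z) \<bullet> F' v)) (at z)"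
    using has_derivative_compose[OF assms(1) has_derivative_gradient[OF assms(2)]] .
  then have "(\<lambda>z. f (F z)) differentiable at z"
    by (rule differentiableI)
  from has_derivative_unique[OF has_derivative_gradient[OF this] d]
  show ?thesis by meson
qed

section \<open>Polynomial functions in coordinates\<close>

lemma rpf_inner_const: "real_polynomial_function (\<lambda>z::'a::euclidean_space. z \<bullet> v)"
  by (intro real_polynomial_function.intros(1) bounded_linear_inner_left)

text \<open>
  A linear functional is a combination of coordinates, so the class of polynomial functions is
  generated by the coordinates alone. A bracket is prescribed on coordinates, and every argument
  that extends a property of brackets from there to all polynomials runs through this rule.
\<close>

lemma rpf_induct [consumes 1, case_names coordinate const add mult]:
  fixes f :: "'a::euclidean_space \<Rightarrow> real"
  assumes "real_polynomial_function f"
    and coordinate: "\<And>i. i \<in> Basis \<Longrightarrow> P (\<lambda>z. z \<bullet> i)"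
    and const: "\<And>c. P (\<lambda>z. c)"
    and add: "\<And>f g. \<lbrakk>real_polynomial_function f; P f; real_polynomial_function g; P g\<rbrakk>
      \<Longrightarrow> P (\<lambda>z. f z + g z)"
    and mult: "\<And>f g. \<lbrakk>real_polynomial_function f; P f; real_polynomial_function g; P g\<rbrakk>
      \<Longrightarrow> P (\<lambda>z. f z * g z)"
  shows "P f"
  using assms(1)
proof (induction rule: real_polynomial_function.induct)
  case (linear f)
  have monomial: "real_polynomial_function (\<lambda>z. f i * (z \<bullet> i)) \<and> P (\<lambda>z. f i * (z \<bullet> i))"
    if "i \<in> Basis" for i
    using that by (intro conjI mult const coordinate real_polynomial_function.intros(2,4) rpf_inner_const)
  have "real_polynomial_function (\<lambda>z. \<Sum>i\<in>A. f i * (z \<bullet> i)) \<and> P (\<lambda>z. \<Sum>i\<in>A. f i * (z \<bullet> i))"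
    if "finite A" "A \<subseteq> Basis" for A
    using that
  proof (induction A rule: finite_induct)
    case empty
    then show ?case by (auto intro: const)
  next
    case (insert i A)
    with monomial[of i] show ?case
      by (auto intro!: add)
  qed
  from this[of Basis] have "P (\<lambda>z. \<Sum>i\<in>Basis. f i * (z \<bullet> i))" by simp
  moreover have "f = (\<lambda>z. \<Sum>i\<in>Basis. f i * (z \<bullet> i))"
  proof
    fix z
    have "f z = f (\<Sum>i\<in>Basis. (z \<bullet> i) *\<^sub>R i)"
      by (simp add: euclidean_representation)
    also have "\<dots> = (\<Sum>i\<in>Basis. f i * (z \<bullet> i))"
      using linear by (simp add: linear_sum linear_cmul bounded_linear.linear mult.commute)
    finally show "f z = (\<Sum>i\<in>Basis. f i * (z \<bullet> i))" .
  qed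
  ultimately show ?case by simp
qed (auto intro: const add mult)

lemma rpf_gradient:
  assumes "real_polynomial_function f"
  shows "real_polynomial_function (\<lambda>z. gradient f z \<bullet> v)"
  using assms
proof (induction rule: rpf_induct)
  case (add f g)
  then show ?case
    by (simp add: gradient_add differentiable_at_real_polynomial_function inner_simps
        real_polynomial_function.intros(3))
next
  case (mult f g)
  then show ?case
    by (simp add: gradient_mult differentiable_at_real_polynomial_function inner_simps
        real_polynomial_function.intros(3) real_polynomial_function.intros(4))
qed (auto intro: real_polynomial_function.intros)

section \<open>Poisson brackets are determined on coordinates\<close>

lemma restrict_mem_coord_ring: "real_polynomial_function p \<Longrightarrow> restrict p Z \<in> coord_ring Z"
  by (auto simp: coord_ring_def)

text \<open>
  The bracket axioms, with their elements of the coordinate ring written as restrictions of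
  polynomials; this spares the later inductions all bookkeeping about extensionality.
\<close>

lemma poisson_bracket_on_rpf:
  assumes "poisson_bracket_on Z B" "real_polynomial_function f" "real_polynomial_function g"
    "real_polynomial_function k" "z \<in> Z"
  shows "B (restrict f Z) (restrict k Z) z = - B (restrict k Z) (restrict f Z) z"
    and "B (\<lambda>z\<in>Z. a * f z + b * g z) (restrict k Z) z
      = a * B (restrict f Z) (restrict k Z) z + b * B (restrict g Z) (restrict k Z) z"
    and "B (\<lambda>z\<in>Z. f z * g z) (restrict k Z) z
      = f z * B (restrict g Z) (restrict k Z) z + B (restrict f Z) (restrict k Z) z * g z"
proof -
  note mem = assms(2-4)[THEN restrict_mem_coord_ring, of Z]
  show "B (restrict f Z) (restrict k Z) z = - B (restrict k Z) (restrict f Z) z"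
    using assms(1,5) mem unfolding poisson_bracket_on_def by blast
  have "B (\<lambda>z\<in>Z. a * restrict f Z z + b * restrict g Z z) (restrict k Z) z
      = a * B (restrict f Z) (restrict k Z) z + b * B (restrict g Z) (restrict k Z) z"
    using assms(1,5) mem unfolding poisson_bracket_on_def by blast
  moreover have "B (\<lambda>z\<in>Z. restrict f Z z * restrict g Z z) (restrict k Z) z
      = restrict f Z z * B (restrict g Z) (restrict k Z) z
        + B (restrict f Z) (restrict k Z) z * restrict g Z z"
    using assms(1,5) mem unfolding poisson_bracket_on_def by blast
  ultimately show "B (\<lambda>z\<in>Z. a * f z + b * g z) (restrict k Z) z
      = a * B (restrict f Z) (restrict k Z) z + b * B (restrict g Z) (restrict k Z) z"
    and "B (\<lambda>z\<in>Z. f z * g z) (restrict k Z) z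
      = f z * B (restrict g Z) (restrict k Z) z + B (restrict f Z) (restrict k Z) z * g z"
    using \<open>z \<in> Z\<close> by (simp_all cong: restrict_cong)
qed

text \<open>
  By the Leibniz rule, \<open>{1, k} = {1 \<cdot> 1, k} = 2 {1, k}\<close>.
\<close>

lemma poisson_bracket_on_const:
  assumes "poisson_bracket_on Z B" "real_polynomial_function k" "z \<in> Z"
  shows "B (\<lambda>z\<in>Z. c) (restrict k Z) z = 0"
proof -
  note r = real_polynomial_function.intros(2)
  have "B (\<lambda>z\<in>Z. 1) (restrict k Z) z = 0"
    using poisson_bracket_on_rpf(3)[OF assms(1) r[of 1] r[of 1] assms(2,3)] by simp
  then show ?thesis
    using poisson_bracket_on_rpf(2)[OF assms(1) r[of 1] r[of 1] assms(2,3), of c 0] by simp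
qed

text \<open>
  Two brackets that agree on coordinates agree on a polynomial and a coordinate, by induction over
  the polynomial; by skew symmetry they agree on a coordinate and a polynomial, and a second
  induction reaches two polynomials.
\<close>

lemma poisson_bracket_on_eqI:
  assumes B: "poisson_bracket_on Z B" and C: "poisson_bracket_on Z C"
    and coord: "\<And>i j z. \<lbrakk>i \<in> Basis; j \<in> Basis; z \<in> Z\<rbrakk> \<Longrightarrow>
      B (\<lambda>z\<in>Z. z \<bullet> i) (\<lambda>z\<in>Z. z \<bullet> j) z = C (\<lambda>z\<in>Z. z \<bullet> i) (\<lambda>z\<in>Z. z \<bullet> j) z"
  shows "B = C"
proof -
  have extend: "\<forall>z\<in>Z. B (restrict f Z) (restrict k Z) z = C (restrict f Z) (restrict k Z) z"
    if "real_polynomial_function f" and k: "real_polynomial_function k"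
      and on_coord: "\<And>i z. \<lbrakk>i \<in> Basis; z \<in> Z\<rbrakk> \<Longrightarrow>
        B (\<lambda>z\<in>Z. z \<bullet> i) (restrict k Z) z = C (\<lambda>z\<in>Z. z \<bullet> i) (restrict k Z) z"
    for f k
    using that(1)
  proof (induction rule: rpf_induct)
    case (coordinate i)
    then show ?case using on_coord by blast
  next
    case (const c)
    show ?case using poisson_bracket_on_const[OF B k] poisson_bracket_on_const[OF C k] by metis
  next
    case (add f g)
    then show ?case
      using poisson_bracket_on_rpf(2)[OF B add(1,2) k, of _ 1 1]
        poisson_bracket_on_rpf(2)[OF C add(1,2) k, of _ 1 1]
      by (simp del: restrict_apply)
  next
    case (mult f g)
    then show ?case
      using poisson_bracket_on_rpf(3)[OF B mult(1,2) k] poisson_bracket_on_rpf(3)[OF C mult(1,2) k]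
      by (simp del: restrict_apply)
  qed
  have eq: "B (restrict f Z) (restrict k Z) z = C (restrict f Z) (restrict k Z) z"
    if f: "real_polynomial_function f" and k: "real_polynomial_function k" and "z \<in> Z" for f k z
  proof -
    have "B (restrict k Z) (\<lambda>z\<in>Z. z \<bullet> i) z = C (restrict k Z) (\<lambda>z\<in>Z. z \<bullet> i) z"
      if "i \<in> Basis" "z \<in> Z" for i z
      using extend[OF k rpf_inner_const[of i]] coord that by blast
    then have "B (\<lambda>z\<in>Z. z \<bullet> i) (restrict k Z) z = C (\<lambda>z\<in>Z. z \<bullet> i) (restrict k Z) z"
      if "i \<in> Basis" "z \<in> Z" for i z
      using that poisson_bracket_on_rpf(1)[OF B rpf_inner_const[of i] k k \<open>z \<in> Z\<close>]
        poisson_bracket_on_rpf(1)[OF C rpf_inner_const[of i] k k \<open>z \<in> Z\<close>] by simp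
    with extend[OF f k] \<open>z \<in> Z\<close> show ?thesis by blast
  qed
  have type: "B \<in> coord_ring Z \<rightarrow>\<^sub>E (coord_ring Z \<rightarrow>\<^sub>E coord_ring Z)"
      "C \<in> coord_ring Z \<rightarrow>\<^sub>E (coord_ring Z \<rightarrow>\<^sub>E coord_ring Z)"
    using B C by (auto simp: poisson_bracket_on_def)
  show ?thesis
  proof (rule PiE_ext[OF type], rule PiE_ext)
    fix \<phi> assume \<phi>: "\<phi> \<in> coord_ring Z"
    show ty: "B \<phi> \<in> coord_ring Z \<rightarrow>\<^sub>E coord_ring Z" "C \<phi> \<in> coord_ring Z \<rightarrow>\<^sub>E coord_ring Z"
      using type \<phi> by blast+
    fix \<psi> assume \<psi>: "\<psi> \<in> coord_ring Z"
    have ext: "\<rho> \<in> extensional Z" if "\<rho> \<in> coord_ring Z" for \<rho>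
      using that by (auto simp: coord_ring_def)
    have "B \<phi> \<psi> \<in> coord_ring Z" "C \<phi> \<psi> \<in> coord_ring Z"
      using ty \<psi> by blast+
    then have "B \<phi> \<psi> \<in> extensional Z" "C \<phi> \<psi> \<in> extensional Z"
      using ext by blast+
    moreover have "B \<phi> \<psi> z = C \<phi> \<psi> z" if "z \<in> Z" for z
      using \<phi> \<psi> eq that by (auto simp: coord_ring_def)
    ultimately show "B \<phi> \<psi> = C \<phi> \<psi>"
      by (rule extensionalityI)
  qed
qed

section \<open>Brackets of polynomial bivector fields\<close>

definition tensor_bracket ::
  "('a::euclidean_space \<Rightarrow> 'a \<Rightarrow> 'a) \<Rightarrow> ('a \<Rightarrow> real) \<Rightarrow> ('a \<Rightarrow> real) \<Rightarrow> 'a \<Rightarrow> real" where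
  "tensor_bracket S f g z = gradient f z \<bullet> S z (gradient g z)"

text \<open>
  A bivector field is presented by the linear map \<open>S z\<close> that sends the gradient of \<open>h\<close> to its
  Hamiltonian vector; linearity follows from skew symmetry. The coordinate functions
  have the brackets \<open>i \<bullet> S z j\<close>, and \<open>i \<bullet> S z (gradient F z)\<close> is the bracket of the coordinate \<open>i\<close>
  with \<open>F\<close>, so the last assumption is the Jacobi identity for three coordinates.
\<close>

locale poisson_tensor =
  fixes S :: "'a::euclidean_space \<Rightarrow> 'a \<Rightarrow> 'a"
  assumes skew: "u \<bullet> S z v = - (v \<bullet> S z u)"
    and poly: "\<lbrakk>i \<in> Basis; j \<in> Basis\<rbrakk> \<Longrightarrow> real_polynomial_function (\<lambda>z. i \<bullet> S z j)"
    and jacobi_coordinates: "\<lbrakk>i \<in> Basis; j \<in> Basis; k \<in> Basis\<rbrakk> \<Longrightarrow>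
      i \<bullet> S z (gradient (\<lambda>z. j \<bullet> S z k) z) + j \<bullet> S z (gradient (\<lambda>z. k \<bullet> S z i) z)
        + k \<bullet> S z (gradient (\<lambda>z. i \<bullet> S z j) z) = 0"
begin

abbreviation bracket where "bracket \<equiv> tensor_bracket S"

lemma bracket_skew: "bracket f g z = - bracket g f z"
  unfolding tensor_bracket_def by (rule skew)

lemma bracket_const [simp]: "bracket (\<lambda>z. c) g z = 0"
  by (simp add: tensor_bracket_def)

lemma bracket_add:
  assumes "real_polynomial_function f" "real_polynomial_function g"
  shows "bracket (\<lambda>z. f z + g z) k z = bracket f k z + bracket g k z"
  using assms
  by (simp add: tensor_bracket_def gradient_add differentiable_at_real_polynomial_function
      inner_simps)

lemma bracket_mult:
  assumes "real_polynomial_function f" "real_polynomial_function g"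
  shows "bracket (\<lambda>z. f z * g z) k z = f z * bracket g k z + g z * bracket f k z"
  using assms
  by (simp add: tensor_bracket_def gradient_mult differentiable_at_real_polynomial_function
      inner_simps)

lemma inner_S_expand:
  "u \<bullet> S z v = (\<Sum>i\<in>Basis. \<Sum>j\<in>Basis. (u \<bullet> i) * (v \<bullet> j) * (i \<bullet> S z j))"
proof -
  have u: "u \<bullet> S z v = (\<Sum>i\<in>Basis. (u \<bullet> i) * (i \<bullet> S z v))" for u v
    using euclidean_inner[of u "S z v"] by (simp add: inner_commute)
  have "i \<bullet> S z v = (\<Sum>j\<in>Basis. (v \<bullet> j) * (i \<bullet> S z j))" for i v
    by (subst skew, subst u) (simp add: skew[of i z] sum_negf)
  then have "u \<bullet> S z v = (\<Sum>i\<in>Basis. (u \<bullet> i) * (\<Sum>j\<in>Basis. (v \<bullet> j) * (i \<bullet> S z j)))"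
    by (subst u) (intro sum.cong refl arg_cong[where f = "(*) _"])
  then show ?thesis
    by (simp only: sum_distrib_left mult.assoc)
qed

text \<open>
  The values of a bracket must again be polynomial for brackets to be iterated.
\<close>

lemma rpf_bracket:
  assumes "real_polynomial_function f" "real_polynomial_function g"
  shows "real_polynomial_function (bracket f g)"
  unfolding tensor_bracket_def inner_S_expand[of "gradient f _"]
  by (intro real_polynomial_function_sum real_polynomial_function.intros(4) rpf_gradient assms poly)
    auto

definition jacobiator where
  "jacobiator f g k z =
    bracket f (bracket g k) z + bracket g (bracket k f) z + bracket k (bracket f g) z"

text \<open>
  The terms of the Jacobi sum in which \<open>f\<close> and \<open>f'\<close> are differentiated by different brackets, such
  as \<open>{k, f} {g, f'}\<close>, occur twice with opposite signs.
\<close>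

lemma jacobiator_derivation:
  assumes "real_polynomial_function f" "real_polynomial_function f'"
    "real_polynomial_function g" "real_polynomial_function k"
  shows "jacobiator (\<lambda>z. f z + f' z) g k z = jacobiator f g k z + jacobiator f' g k z"
    and "jacobiator (\<lambda>z. f z * f' z) g k z = f z * jacobiator f' g k z + f' z * jacobiator f g k z"
proof -
  note r = assms real_polynomial_function.intros(3,4) rpf_bracket
  have R: "bracket a (\<lambda>z. b z + c z) z = bracket a b z + bracket a c z"
       "bracket a (\<lambda>z. b z * c z) z = b z * bracket a c z + c z * bracket a b z"
    if "real_polynomial_function b" "real_polynomial_function c" for a b c z
    by (simp_all only: bracket_skew[of a _ z] bracket_add[OF that] bracket_mult[OF that])
  have a1: "bracket (\<lambda>z. f z + f' z) g = (\<lambda>z. bracket f g z + bracket f' g z)"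
    by (rule ext, rule bracket_add) (use assms in auto)
  have a2: "bracket k (\<lambda>z. f z + f' z) = (\<lambda>z. bracket k f z + bracket k f' z)"
    by (rule ext, rule R) (use assms in auto)
  show "jacobiator (\<lambda>z. f z + f' z) g k z = jacobiator f g k z + jacobiator f' g k z"
    unfolding jacobiator_def a1 a2 bracket_add[OF assms(1,2)]
    using assms by (simp add: R rpf_bracket)
  have m1: "bracket (\<lambda>z. f z * f' z) g = (\<lambda>z. f z * bracket f' g z + f' z * bracket f g z)"
    by (rule ext, rule bracket_mult) (use assms in auto)
  have m2: "bracket k (\<lambda>z. f z * f' z) = (\<lambda>z. f z * bracket k f' z + f' z * bracket k f z)"
    by (rule ext, rule R) (use assms in auto)
  have "bracket g (bracket k (\<lambda>z. f z * f' z)) z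
      = f z * bracket g (bracket k f') z + bracket k f' z * bracket g f z
        + (f' z * bracket g (bracket k f) z + bracket k f z * bracket g f' z)"
    unfolding m2 by (subst R, (intro r)+)+ simp
  moreover have "bracket k (bracket (\<lambda>z. f z * f' z) g) z
      = f z * bracket k (bracket f' g) z + bracket f' g z * bracket k f z
        + (f' z * bracket k (bracket f g) z + bracket f g z * bracket k f' z)"
    unfolding m1 by (subst R, (intro r)+)+ simp
  ultimately show "jacobiator (\<lambda>z. f z * f' z) g k z
      = f z * jacobiator f' g k z + f' z * jacobiator f g k z"
    unfolding jacobiator_def bracket_mult[OF assms(1,2)]
      bracket_skew[of g f z] bracket_skew[of g f' z] bracket_skew[of k f z] bracket_skew[of k f' z]
    by algebra
qed

text \<open>
  The Jacobi sum is cyclically symmetric and a derivation in its first argument. Hence it vanishes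
  as soon as it vanishes on triples of coordinates: one argument after another is rotated to the
  front and released from being a coordinate.
\<close>

lemma jacobiator_eq_0:
  assumes "real_polynomial_function f" "real_polynomial_function g" "real_polynomial_function k"
  shows "jacobiator f g k z = 0"
proof -
  have extend: "\<forall>z. jacobiator f g k z = 0"
    if "real_polynomial_function f" "real_polynomial_function g" "real_polynomial_function k"
      and "\<And>i z. i \<in> Basis \<Longrightarrow> jacobiator (\<lambda>z. z \<bullet> i) g k z = 0"
    for f g k
    using that(1)
  proof (induction rule: rpf_induct)
    case (const c)
    have "bracket (\<lambda>z. c) g = (\<lambda>z. 0)" for g by (rule ext) simp
    moreover have "bracket g (\<lambda>z. c) = (\<lambda>z. 0)" for g c using bracket_skew by fastforce
    ultimately show ?case by (simp add: jacobiator_def)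
  qed (use that jacobiator_derivation in auto)
  have cyclic: "jacobiator f g k z = jacobiator g k f z" for f g k z
    by (simp add: jacobiator_def)
  have base: "jacobiator (\<lambda>z. z \<bullet> i) (\<lambda>z. z \<bullet> j) (\<lambda>z. z \<bullet> k) z = 0"
    if "i \<in> Basis" "j \<in> Basis" "k \<in> Basis" for i j k z
  proof -
    have "bracket (\<lambda>z. z \<bullet> i) (\<lambda>z. z \<bullet> j) = (\<lambda>z. i \<bullet> S z j)" for i j
      by (rule ext) (simp add: tensor_bracket_def)
    then show ?thesis
      using jacobi_coordinates[OF that, of z] by (simp add: jacobiator_def tensor_bracket_def)
  qed
  have 1: "jacobiator f (\<lambda>z. z \<bullet> j) (\<lambda>z. z \<bullet> k) z = 0"
    if "j \<in> Basis" "k \<in> Basis" "real_polynomial_function f" for f j k z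
    using extend[of f "\<lambda>z. z \<bullet> j" "\<lambda>z. z \<bullet> k"] base that rpf_inner_const by blast
  have 2: "jacobiator f g (\<lambda>z. z \<bullet> k) z = 0"
    if "k \<in> Basis" "real_polynomial_function f" "real_polynomial_function g" for f g k z
    using extend[of g "\<lambda>z. z \<bullet> k" f] 1 that rpf_inner_const cyclic by metis
  show ?thesis
    using extend[of k f g] 2 assms cyclic by metis
qed

end

section \<open>Varieties with a Poisson ideal\<close>

text \<open>
  The Hamiltonian vectors along \<open>Z\<close> annihilate every polynomial that vanishes on \<open>Z\<close>. This is what
  makes the bracket of two restrictions to \<open>Z\<close> independent of the polynomials that represent them.
\<close>

locale poisson_variety = poisson_tensor +
  fixes Z :: "'a set"
  assumes tangent: "\<lbrakk>real_polynomial_function f; \<And>z. z \<in> Z \<Longrightarrow> f z = 0; z \<in> Z\<rbrakk>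
    \<Longrightarrow> gradient f z \<bullet> S z v = 0"
begin

text \<open>
  An element of the coordinate ring determines its representing polynomial only up to the vanishing
  ideal of \<open>Z\<close>; the bracket does not depend on the choice.
\<close>

definition representative :: "('a \<Rightarrow> real) \<Rightarrow> 'a \<Rightarrow> real" where
  "representative \<phi> = (SOME p. real_polynomial_function p \<and> \<phi> = restrict p Z)"

lemma representative:
  assumes "\<phi> \<in> coord_ring Z"
  shows "real_polynomial_function (representative \<phi>)" "restrict (representative \<phi>) Z = \<phi>"
proof -
  have "\<exists>p. real_polynomial_function p \<and> \<phi> = restrict p Z"
    using assms by (auto simp: coord_ring_def)
  from someI_ex[OF this]
  show "real_polynomial_function (representative \<phi>)" "restrict (representative \<phi>) Z = \<phi>"
    by (auto simp: representative_def)
qed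

definition induced where
  "induced = (\<lambda>\<phi>\<in>coord_ring Z. \<lambda>\<psi>\<in>coord_ring Z.
    restrict (bracket (representative \<phi>) (representative \<psi>)) Z)"

lemma bracket_cong_left:
  assumes "real_polynomial_function f" "real_polynomial_function f'"
    and eq: "restrict f Z = restrict f' Z" and "z \<in> Z"
  shows "bracket f g z = bracket f' g z"
proof -
  have 1: "real_polynomial_function (\<lambda>z. f z - f' z)"
    by (intro real_polynomial_function_diff assms)
  have "f z = f' z" if "z \<in> Z" for z
    using eq that by (metis restrict_apply')
  then have "gradient (\<lambda>z. f z - f' z) z \<bullet> S z (gradient g z) = 0"
    using tangent[OF 1 _ \<open>z \<in> Z\<close>] by simp
  moreover have "gradient (\<lambda>z. f z - f' z) z = gradient f z - gradient f' z"
    by (rule gradient_diff; rule differentiable_at_real_polynomial_function, rule assms)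
  ultimately show ?thesis
    by (simp add: tensor_bracket_def inner_simps)
qed

lemma induced_restrict:
  assumes f: "real_polynomial_function f" and g: "real_polynomial_function g"
  shows "induced (restrict f Z) (restrict g Z) = restrict (bracket f g) Z"
proof (rule extensionalityI[where A = Z])
  fix z assume z: "z \<in> Z"
  let ?f = "representative (restrict f Z)" and ?g = "representative (restrict g Z)"
  note rf = representative[OF restrict_mem_coord_ring[OF f]]
  note rg = representative[OF restrict_mem_coord_ring[OF g]]
  have "bracket ?f ?g z = bracket f ?g z"
    by (rule bracket_cong_left[OF rf(1) f rf(2) z])
  also have "\<dots> = - bracket ?g f z"
    by (rule bracket_skew)
  also have "\<dots> = - bracket g f z"
    by (simp only: bracket_cong_left[OF rg(1) g rg(2) z])
  also have "\<dots> = bracket f g z"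
    by (rule bracket_skew[symmetric])
  finally show "induced (restrict f Z) (restrict g Z) z = restrict (bracket f g) Z z"
    using z by (simp add: induced_def restrict_mem_coord_ring f g)
qed (auto simp: induced_def restrict_mem_coord_ring f g)

lemma poisson_bracket_on_induced: "poisson_bracket_on Z induced"
proof -
  have all: "(\<forall>\<phi>\<in>coord_ring Z. Q \<phi>) \<longleftrightarrow> (\<forall>f. real_polynomial_function f \<longrightarrow> Q (restrict f Z))"
    for Q :: "('a \<Rightarrow> real) \<Rightarrow> bool"
    by (auto simp: coord_ring_def)
  note r = rpf_bracket real_polynomial_function.intros(2-4) induced_restrict
  show ?thesis
    unfolding poisson_bracket_on_def all
  proof (intro conjI allI impI ballI)
    show "induced \<in> coord_ring Z \<rightarrow>\<^sub>E coord_ring Z \<rightarrow>\<^sub>E coord_ring Z"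
      unfolding induced_def
      by (intro restrict_PiE_iff[THEN iffD2] ballI restrict_mem_coord_ring rpf_bracket
          representative)
  next
    fix f g :: "'a \<Rightarrow> real" and z
    assume "real_polynomial_function f" "real_polynomial_function g" "z \<in> Z"
    then show "induced (restrict f Z) (restrict g Z) z = - induced (restrict g Z) (restrict f Z) z"
      using bracket_skew[of f g z] by (simp add: r)
  next
    fix f g k :: "'a \<Rightarrow> real" and a b z
    assume rpf: "real_polynomial_function f" "real_polynomial_function g"
      "real_polynomial_function k" and z: "z \<in> Z"
    have "(\<lambda>z\<in>Z. a * restrict f Z z + b * restrict g Z z) = restrict (\<lambda>z. a * f z + b * g z) Z"
      by auto
    with rpf z show "induced (\<lambda>z\<in>Z. a * restrict f Z z + b * restrict g Z z) (restrict k Z) z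
        = a * induced (restrict f Z) (restrict k Z) z + b * induced (restrict g Z) (restrict k Z) z"
      by (simp add: r bracket_add bracket_mult)
    have "(\<lambda>z\<in>Z. restrict f Z z * restrict g Z z) = restrict (\<lambda>z. f z * g z) Z"
      by auto
    with rpf z show "induced (\<lambda>z\<in>Z. restrict f Z z * restrict g Z z) (restrict k Z) z
        = restrict f Z z * induced (restrict g Z) (restrict k Z) z
          + induced (restrict f Z) (restrict k Z) z * restrict g Z z"
      by (simp add: r bracket_mult)
    show "induced (restrict f Z) (induced (restrict g Z) (restrict k Z)) z
        + induced (restrict g Z) (induced (restrict k Z) (restrict f Z)) z
        + induced (restrict k Z) (induced (restrict f Z) (restrict g Z)) z = 0"
      using jacobiator_eq_0[OF rpf, of z] rpf z by (simp add: r jacobiator_def)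
  qed
qed

lemma induced_coordinates:
  "induced (\<lambda>z\<in>Z. z \<bullet> u) (\<lambda>z\<in>Z. z \<bullet> v) = (\<lambda>z\<in>Z. u \<bullet> S z v)"
  unfolding induced_restrict[OF rpf_inner_const rpf_inner_const]
  by (rule restrict_ext) (simp add: tensor_bracket_def)

text \<open>
  Both sides are built from the same values of \<open>frechet_derivative h\<close>, so the identity extends from
  polynomials to every \<open>h\<close>.
\<close>

lemma bracket_ext_induced:
  assumes "z \<in> Z"
  shows "bracket_ext Z induced (\<lambda>z. z \<bullet> u) h z = u \<bullet> S z (gradient h z)"
proof -
  have "bracket_ext Z induced (\<lambda>z. z \<bullet> u) h z
      = - (\<Sum>j\<in>Basis. frechet_derivative h (at z) j * (j \<bullet> S z u))"
    using assms skew[of u z]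
    by (simp add: bracket_ext_def induced_coordinates mult.commute sum_negf[symmetric])
  also have "\<dots> = - (gradient h z \<bullet> S z u)"
    by (simp add: gradient_def inner_sum_left)
  also have "\<dots> = u \<bullet> S z (gradient h z)"
    by (rule skew[symmetric])
  finally show ?thesis .
qed

lemma hamiltonian_field_induced:
  assumes "z \<in> Z"
  shows "hamiltonian_field Z induced h z = S z (gradient h z)"
  unfolding hamiltonian_field_def bracket_ext_induced[OF assms]
  by (subst (2) euclidean_representation[symmetric]) (simp add: inner_commute)

text \<open>
  Along a solution the derivative of \<open>f\<close> is its bracket with \<open>h\<close>, and the time domain is an interval.
\<close>

lemma first_integral_onI:
  assumes "D \<subseteq> Z"
    and diff: "\<And>z. z \<in> D \<Longrightarrow> f differentiable at z"
    and commute: "\<And>z. z \<in> D \<Longrightarrow> gradient f z \<bullet> S z (gradient h z) = 0"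
  shows "first_integral_on (hamiltonian_field Z induced h) D f"
  unfolding first_integral_on_def
proof (intro allI impI ballI)
  fix I c s t
  assume sol: "solution_on (hamiltonian_field Z induced h) D I c" and st: "s \<in> I" "t \<in> I"
  have "((\<lambda>t. f (c t)) has_derivative (\<lambda>_. 0)) (at t within I)" if "t \<in> I" for t
  proof -
    have ct: "c t \<in> D" and "(c has_vector_derivative S (c t) (gradient h (c t))) (at t)"
      using sol that \<open>D \<subseteq> Z\<close> by (auto simp: solution_on_def hamiltonian_field_induced subset_iff)
    then have "(c has_derivative (\<lambda>x. x *\<^sub>R S (c t) (gradient h (c t)))) (at t)"
      by (simp add: has_vector_derivative_def)
    from has_derivative_compose[OF this has_derivative_gradient[OF diff[OF ct]]]
    show ?thesis
      using commute[OF ct] by (simp add: has_derivative_at_withinI)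
  qed
  moreover have "convex I"
    using sol by (simp add: solution_on_def is_interval_convex_1)
  ultimately show "f (c s) = f (c t)"
    using st has_derivative_zero_unique by blast
qed

lemma energy_first_integral:
  assumes "D \<subseteq> Z" "\<And>z. z \<in> D \<Longrightarrow> h differentiable at z"
  shows "first_integral_on (hamiltonian_field Z induced h) D h"
proof (rule first_integral_onI[OF assms])
  fix z show "gradient h z \<bullet> S z (gradient h z) = 0"
    using skew[of "gradient h z" z "gradient h z"] by linarith
qed

end

section \<open>Vectors in dimensions three and four\<close>

lemma vector_4 [simp]:
  "(vector [a, b, c, d] :: 'a::zero^4) $ 1 = a"
  "(vector [a, b, c, d] :: 'a::zero^4) $ 2 = b"
  "(vector [a, b, c, d] :: 'a::zero^4) $ 3 = c"
  "(vector [a, b, c, d] :: 'a::zero^4) $ 4 = d"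
  unfolding vector_def by simp_all

lemma vec3_eq_iff: "(u :: 'a^3) = v \<longleftrightarrow> u$1 = v$1 \<and> u$2 = v$2 \<and> u$3 = v$3"
  by (simp add: vec_eq_iff forall_3)

lemma vec4_eq_iff: "(u :: 'a^4) = v \<longleftrightarrow> u$1 = v$1 \<and> u$2 = v$2 \<and> u$3 = v$3 \<and> u$4 = v$4"
  by (simp add: vec_eq_iff forall_4)

lemma inner_vec3: "(u :: real^3) \<bullet> v = u$1 * v$1 + u$2 * v$2 + u$3 * v$3"
  by (simp add: inner_vec_def sum_3)

lemma inner_vec4: "(u :: real^4) \<bullet> v = u$1 * v$1 + u$2 * v$2 + u$3 * v$3 + u$4 * v$4"
  by (simp add: inner_vec_def sum_4)

lemma has_derivative_vec_nth [derivative_intros]: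
  "(f has_derivative f') F \<Longrightarrow> ((\<lambda>x. f x $ i) has_derivative (\<lambda>x. f' x $ i)) F"
  by (rule bounded_linear.has_derivative[OF bounded_linear_vec_nth])

lemma mem_Vvar_iff:
  "(x, y) \<in> Vvar \<longleftrightarrow> (x$1)^2 + (x$2)^2 - (x$3)^2 + 1 = 0 \<and> x$1 * y$1 + x$2 * y$2 - x$3 * y$3 = 0"
  by (simp add: Vvar_def lor_def power2_eq_square)

section \<open>The Dirac bracket on the tangent bundle of the hyperboloid\<close>

text \<open>
  The Gram matrix of the Lorentz form, as a map: \<open>lor u v = u \<bullet> lflip v\<close>.
\<close>

definition lflip :: "real^3 \<Rightarrow> real^3" where
  "lflip v = vector [v$1, v$2, - v$3]"

lemma lflip_self_adjoint: "lflip u \<bullet> v = u \<bullet> lflip v"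
  by (simp add: lflip_def inner_vec3)

lemma lflip_linear:
  "lflip (u + v) = lflip u + lflip v" "lflip (u - v) = lflip u - lflip v"
  "lflip (r *\<^sub>R u) = r *\<^sub>R lflip u"
  by (simp_all add: lflip_def vec3_eq_iff)

text \<open>
  For the gradient \<open>w = (a, b)\<close> of \<open>h\<close>, this is the pair of vectors \<open>{x, h}\<close> and \<open>{y, h}\<close> that results
  from the prescribed brackets of coordinates. The formula defines a Poisson structure on all of
  \<open>\<real>\<^sup>6\<close>; the equations of the variety enter only for tangency.
\<close>

definition dirac_tensor :: "(real^3) \<times> (real^3) \<Rightarrow> (real^3) \<times> (real^3) \<Rightarrow> (real^3) \<times> (real^3)" where
  "dirac_tensor z w =
    (lflip (snd w) + (fst z \<bullet> snd w) *\<^sub>R fst z,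
     - lflip (fst w) - (fst z \<bullet> fst w) *\<^sub>R fst z + (snd z \<bullet> snd w) *\<^sub>R fst z
       - (fst z \<bullet> snd w) *\<^sub>R snd z)"

lemma inner_dirac_tensor:
  "u \<bullet> dirac_tensor z v =
    fst u \<bullet> lflip (snd v) - snd u \<bullet> lflip (fst v)
    + (fst z \<bullet> fst u) * (fst z \<bullet> snd v) - (fst z \<bullet> snd u) * (fst z \<bullet> fst v)
    + (fst z \<bullet> snd u) * (snd z \<bullet> snd v) - (snd z \<bullet> snd u) * (fst z \<bullet> snd v)"
  by (simp add: dirac_tensor_def inner_prod_def inner_simps inner_commute algebra_simps)

lemma gradient_dirac_tensor:
  "gradient (\<lambda>z. u \<bullet> dirac_tensor z v) z =
    ((fst z \<bullet> snd v) *\<^sub>R fst u + (fst z \<bullet> fst u) *\<^sub>R snd v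
       - (fst z \<bullet> fst v) *\<^sub>R snd u - (fst z \<bullet> snd u) *\<^sub>R fst v
       + (snd z \<bullet> snd v) *\<^sub>R snd u - (snd z \<bullet> snd u) *\<^sub>R snd v,
     (fst z \<bullet> snd u) *\<^sub>R snd v - (fst z \<bullet> snd v) *\<^sub>R snd u)"
  unfolding inner_dirac_tensor
  by (rule gradient_eqI)
    (auto intro!: derivative_eq_intros simp: inner_prod_def inner_simps inner_commute algebra_simps)

lemma rpf_fst_snd:
  fixes c :: "'a::euclidean_space" and d :: "'b::euclidean_space"
  shows "real_polynomial_function (\<lambda>z::'a \<times> 'b. fst z \<bullet> c)"
    and "real_polynomial_function (\<lambda>z::'a \<times> 'b. snd z \<bullet> d)"
  using rpf_inner_const[of "(c, 0::'b)"] rpf_inner_const[of "(0::'a, d)"]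
  by (simp_all add: inner_prod_def)

lemma poisson_tensor_dirac: "poisson_tensor dirac_tensor"
proof
  fix u z v :: "(real^3) \<times> (real^3)"
  show "u \<bullet> dirac_tensor z v = - (v \<bullet> dirac_tensor z u)"
    using lflip_self_adjoint[of "fst u" "snd v"] lflip_self_adjoint[of "snd u" "fst v"]
    by (simp add: inner_dirac_tensor inner_commute)
next
  fix i j :: "(real^3) \<times> (real^3)"
  show "real_polynomial_function (\<lambda>z. i \<bullet> dirac_tensor z j)"
    unfolding inner_dirac_tensor
    by (intro real_polynomial_function.intros(2-4) real_polynomial_function_diff rpf_fst_snd)
next
  fix i j k z :: "(real^3) \<times> (real^3)"
  obtain a1 b1 a2 b2 a3 b3 where ijk: "i = (a1, b1)" "j = (a2, b2)" "k = (a3, b3)"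
    by (meson surj_pair)
  have c: "u \<bullet> lflip v = v \<bullet> lflip u" for u v
    by (metis lflip_self_adjoint inner_commute)
  show "i \<bullet> dirac_tensor z (gradient (\<lambda>z. j \<bullet> dirac_tensor z k) z)
      + j \<bullet> dirac_tensor z (gradient (\<lambda>z. k \<bullet> dirac_tensor z i) z)
      + k \<bullet> dirac_tensor z (gradient (\<lambda>z. i \<bullet> dirac_tensor z j) z) = 0"
    unfolding ijk gradient_dirac_tensor
    unfolding inner_dirac_tensor fst_conv snd_conv lflip_linear inner_simps
    using c[of a1 b2] c[of a1 b3] c[of a2 b1] c[of a2 b3] c[of a3 b1] c[of a3 b2]
      c[of b1 b2] c[of b1 b3] c[of b3 b2]
    by (simp add: algebra_simps)
qed

text \<open>
  The straight line \<open>(x + t u, y + t v)\<close> is pushed back onto the variety: the first component is scaled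
  to Lorentz norm \<open>-1\<close>, and the second is made Lorentz orthogonal to the first by adding a multiple of
  it. Since \<open>lor (x + t u) (x + t u) = - 1 + t\<^sup>2 lor u u\<close> and \<open>lor (x + t u) (y + t v) = t\<^sup>2 lor u v\<close>, both
  corrections are of second order in \<open>t\<close> and do not change the velocity.
\<close>

lemma Vvar_tangent_curve:
  assumes z: "(x, y) \<in> Vvar" and tx: "lor x u = 0" and ty: "lor u y + lor x v = 0"
  shows "\<exists>c. c 0 = (x, y) \<and> (c has_vector_derivative (u, v)) (at (0::real))
    \<and> (\<forall>\<^sub>F t in nhds 0. c t \<in> Vvar)"
proof (intro exI conjI)
  define \<phi> where "\<phi> t = 1 / sqrt (1 - t\<^sup>2 * lor u u)" for t
  let ?c = "\<lambda>t. (\<phi> t *\<^sub>R (x + t *\<^sub>R u), y + t *\<^sub>R v + ((\<phi> t)\<^sup>2 * t\<^sup>2 * lor u v) *\<^sub>R (x + t *\<^sub>R u))"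
  show "?c 0 = (x, y)" by (simp add: \<phi>_def)
  have \<phi>': "(\<phi> has_real_derivative 0) (at 0)"
    unfolding \<phi>_def by (auto intro!: derivative_eq_intros)
  then have \<phi>'': "(\<phi> has_derivative (\<lambda>t. 0)) (at 0)"
    by (simp add: has_field_derivative_def lambda_zero)
  have \<phi>0: "\<phi> 0 = 1" by (simp add: \<phi>_def)
  show "(?c has_vector_derivative (u, v)) (at 0)"
    unfolding has_vector_derivative_def
    by (auto intro!: derivative_eq_intros \<phi>'' simp: \<phi>0)
  have "\<forall>\<^sub>F t in nhds 0. t\<^sup>2 * lor u u < 1"
  proof -
    have "((\<lambda>t::real. t\<^sup>2 * lor u u) \<longlongrightarrow> 0\<^sup>2 * lor u u) (nhds 0)"
      by (intro tendsto_intros filterlim_ident)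
    then show ?thesis by (intro order_tendstoD(2)) auto
  qed
  then show "\<forall>\<^sub>F t in nhds 0. ?c t \<in> Vvar"
  proof (rule eventually_mono)
    fix t assume t: "t\<^sup>2 * lor u u < 1"
    then have sq: "(\<phi> t)\<^sup>2 * (1 - t\<^sup>2 * lor u u) = 1"
      by (simp add: \<phi>_def power_divide)
    have "lor x x = - 1" "lor x y = 0"
      using z by (auto simp: Vvar_def)
    have 1: "lor (x + t *\<^sub>R u) (x + t *\<^sub>R u) = - (1 - t\<^sup>2 * lor u u)"
    proof -
      have "lor (x + t *\<^sub>R u) (x + t *\<^sub>R u) = lor x x + 2 * t * lor x u + t\<^sup>2 * lor u u"
        by (simp add: lor_def algebra_simps power2_eq_square)
      with \<open>lor x x = - 1\<close> tx show ?thesis by simp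
    qed
    have 2: "lor (x + t *\<^sub>R u) (y + t *\<^sub>R v) = t\<^sup>2 * lor u v"
    proof -
      have "lor (x + t *\<^sub>R u) (y + t *\<^sub>R v) = lor x y + t * (lor u y + lor x v) + t\<^sup>2 * lor u v"
        by (simp add: lor_def algebra_simps power2_eq_square)
      with \<open>lor x y = 0\<close> ty show ?thesis by simp
    qed
    have s: "lor (a *\<^sub>R w) w' = a * lor w w'" "lor w (a *\<^sub>R w') = a * lor w w'"
        "lor w (w' + w'') = lor w w' + lor w w''" for a w w' w''
      by (simp_all add: lor_def algebra_simps)
    have "lor (\<phi> t *\<^sub>R (x + t *\<^sub>R u)) (\<phi> t *\<^sub>R (x + t *\<^sub>R u)) = - 1"
      using sq by (simp only: s(1,2) 1) algebra
    moreover have "lor (\<phi> t *\<^sub>R (x + t *\<^sub>R u))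
        ((y + t *\<^sub>R v) + ((\<phi> t)\<^sup>2 * t\<^sup>2 * lor u v) *\<^sub>R (x + t *\<^sub>R u)) = 0"
      using sq by (simp only: s(1,2) s(3)[of _ "y + t *\<^sub>R v"] 1 2) algebra
    ultimately show "?c t \<in> Vvar"
      by (simp add: Vvar_def)
  qed
qed

text \<open>
  The variety is smooth, and a function that vanishes on it has derivative zero along the curves
  just constructed.
\<close>

lemma gradient_Vvar_tangent:
  assumes f: "real_polynomial_function f" and zero: "\<And>z. z \<in> Vvar \<Longrightarrow> f z = 0"
    and z: "(x, y) \<in> Vvar" and tangent: "lor x u = 0" "lor u y + lor x v = 0"
  shows "gradient f (x, y) \<bullet> (u, v) = 0"
proof -
  obtain c where c: "c 0 = (x, y)" "(c has_vector_derivative (u, v)) (at (0::real))"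
    "\<forall>\<^sub>F t in nhds 0. c t \<in> Vvar"
    using Vvar_tangent_curve[OF z tangent] by blast
  have "(c has_derivative (\<lambda>t. t *\<^sub>R (u, v))) (at 0)"
    using c(2) by (simp only: has_vector_derivative_def)
  from has_derivative_compose[OF this has_derivative_gradient, of f]
  have "((\<lambda>t. f (c t)) has_derivative (\<lambda>t. gradient f (x, y) \<bullet> (t *\<^sub>R (u, v)))) (at 0)"
    using f by (simp only: c(1) differentiable_at_real_polynomial_function)
  moreover have "((\<lambda>t. f (c t)) has_derivative (\<lambda>t. 0)) (at 0)"
  proof (rule has_derivative_transform_eventually[OF has_derivative_const])
    have "\<forall>\<^sub>F t in at 0. c t \<in> Vvar"
      using c(3) unfolding eventually_nhds_conv_at by (rule conjunct1)
    then show "\<forall>\<^sub>F t in at 0. 0 = f (c t)"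
      by (rule eventually_mono) (rule zero[symmetric])
    show "0 = f (c 0)"
      unfolding c(1) zero[OF z] by (rule refl)
  qed (rule UNIV_I)
  ultimately have "(\<lambda>t. gradient f (x, y) \<bullet> (t *\<^sub>R (u, v))) = (\<lambda>t::real. 0)"
    by (rule has_derivative_unique)
  from fun_cong[OF this, of 1] show ?thesis
    by (simp only: scaleR_one)
qed

text \<open>
  The brackets of the two defining polynomials with any function vanish on the variety, which says
  that Hamiltonian vectors are tangent.
\<close>

lemma poisson_variety_dirac: "poisson_variety dirac_tensor Vvar"
proof (intro poisson_variety.intro poisson_variety_axioms.intro poisson_tensor_dirac)
  fix f :: "(real^3) \<times> (real^3) \<Rightarrow> real" and z v :: "(real^3) \<times> (real^3)"
  assume f: "real_polynomial_function f" "\<And>z. z \<in> Vvar \<Longrightarrow> f z = 0" and z: "z \<in> Vvar"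
  obtain x y where xy: "z = (x, y)" by fastforce
  obtain a b where ab: "v = (a, b)" by fastforce
  have V: "lor x x = - 1" "lor x y = 0"
    using z by (auto simp: Vvar_def xy)
  let ?u = "lflip b + (x \<bullet> b) *\<^sub>R x"
  let ?v = "- lflip a - (x \<bullet> a) *\<^sub>R x + (y \<bullet> b) *\<^sub>R x - (x \<bullet> b) *\<^sub>R y"
  have l: "lor x (lflip w) = x \<bullet> w" "lor (lflip w) y = y \<bullet> w" for w
    by (simp_all add: lor_def lflip_def inner_vec3)
  have "lor x ?u = x \<bullet> b + (x \<bullet> b) * lor x x"
    by (simp add: l[symmetric]) (simp add: lor_def algebra_simps)
  moreover have "lor ?u y + lor x ?v = y \<bullet> b + (x \<bullet> b) * lor x y - x \<bullet> a - (x \<bullet> a) * lor x x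
      + (y \<bullet> b) * lor x x - (x \<bullet> b) * lor x y"
    unfolding l[symmetric] by (simp add: lor_def algebra_simps)
  ultimately have "lor x ?u = 0" "lor ?u y + lor x ?v = 0"
    using V by simp_all
  from gradient_Vvar_tangent[OF f z[unfolded xy] this]
  show "gradient f z \<bullet> dirac_tensor z v = 0"
    by (simp add: xy ab dirac_tensor_def)
qed

interpretation dirac: poisson_variety dirac_tensor Vvar
  by (rule poisson_variety_dirac)

section \<open>The reduced bracket and the map of invariants\<close>

text \<open>
  The analogue of \<open>dirac_tensor\<close> for the brackets prescribed on the reduced space. This
  also satisfies the Jacobi identity on the whole ambient space.
\<close>

definition reduced_tensor :: "real^4 \<Rightarrow> real^4 \<Rightarrow> real^4" where
  "reduced_tensor w e = vector
    [((w$1)\<^sup>2 - 1) * e$2 + 2 * w$2 * e$3,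
     - ((w$1)\<^sup>2 - 1) * e$1 + 2 * w$1 * w$3 * e$3,
     - 2 * w$2 * e$1 - 2 * w$1 * w$3 * e$2,
     0]"

lemma inner_reduced_tensor:
  "u \<bullet> reduced_tensor w v = ((w$1)\<^sup>2 - 1) * (u$1 * v$2 - u$2 * v$1)
    + 2 * w$2 * (u$1 * v$3 - u$3 * v$1) + 2 * w$1 * w$3 * (u$2 * v$3 - u$3 * v$2)"
  by (simp add: reduced_tensor_def inner_vec4 algebra_simps)

lemma gradient_reduced_tensor:
  "gradient (\<lambda>w. u \<bullet> reduced_tensor w v) w = vector
    [2 * w$1 * (u$1 * v$2 - u$2 * v$1) + 2 * w$3 * (u$2 * v$3 - u$3 * v$2),
     2 * (u$1 * v$3 - u$3 * v$1),
     2 * w$1 * (u$2 * v$3 - u$3 * v$2),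
     0]"
  unfolding inner_reduced_tensor
  by (rule gradient_eqI)
    (auto intro!: derivative_eq_intros simp: inner_vec4 algebra_simps)

lemma rpf_vec_nth: "real_polynomial_function (\<lambda>w::real^'n. w $ i)"
  by (intro real_polynomial_function.intros(1) bounded_linear_vec_nth)

lemma poisson_tensor_reduced: "poisson_tensor reduced_tensor"
proof
  fix u w v :: "real^4"
  show "u \<bullet> reduced_tensor w v = - (v \<bullet> reduced_tensor w u)"
    by (simp add: inner_reduced_tensor algebra_simps)
next
  fix i j :: "real^4"
  show "real_polynomial_function (\<lambda>w. i \<bullet> reduced_tensor w j)"
    unfolding inner_reduced_tensor
    by (intro real_polynomial_function.intros(2-4) real_polynomial_function_diff
        real_polynomial_function_power rpf_vec_nth)
next
  fix i j k w :: "real^4"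
  show "i \<bullet> reduced_tensor w (gradient (\<lambda>w. j \<bullet> reduced_tensor w k) w)
      + j \<bullet> reduced_tensor w (gradient (\<lambda>w. k \<bullet> reduced_tensor w i) w)
      + k \<bullet> reduced_tensor w (gradient (\<lambda>w. i \<bullet> reduced_tensor w j) w) = 0"
    unfolding gradient_reduced_tensor unfolding inner_reduced_tensor vector_4 by algebra
qed

definition Gam_deriv :: "(real^3) \<times> (real^3) \<Rightarrow> (real^3) \<times> (real^3) \<Rightarrow> real^4" where
  "Gam_deriv z v = vector
    [fst v $ 3,
     snd v $ 3,
     2 * (snd z $ 1 * snd v $ 1 + snd z $ 2 * snd v $ 2 - snd z $ 3 * snd v $ 3),
     fst z $ 1 * snd v $ 2 + snd z $ 2 * fst v $ 1
       - fst z $ 2 * snd v $ 1 - snd z $ 1 * fst v $ 2]"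

text \<open>
  The transpose of \<open>Gam_deriv\<close>, which transports gradients back along \<open>Gam\<close>.
\<close>

definition Gam_pullback :: "(real^3) \<times> (real^3) \<Rightarrow> real^4 \<Rightarrow> (real^3) \<times> (real^3)" where
  "Gam_pullback z e =
    (vector [e$4 * snd z $ 2, - e$4 * snd z $ 1, e$1],
     vector [2 * e$3 * snd z $ 1 - e$4 * fst z $ 2, 2 * e$3 * snd z $ 2 + e$4 * fst z $ 1,
       e$2 - 2 * e$3 * snd z $ 3])"

lemma Gam_nth [simp]:
  "Gam z $ 1 = sigma1 z" "Gam z $ 2 = sigma2 z" "Gam z $ 3 = sigma3 z" "Gam z $ 4 = sigma6 z"
  by (simp_all add: Gam_def)

lemma Gam_has_derivative: "(Gam has_derivative Gam_deriv z) (at z)"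
proof -
  have "((\<lambda>z. Gam z $ i) has_derivative (\<lambda>v. Gam_deriv z v $ i)) (at z)" for i
  proof -
    have "\<forall>i. ((\<lambda>z. Gam z $ i) has_derivative (\<lambda>v. Gam_deriv z v $ i)) (at z)"
      unfolding forall_4 Gam_nth Gam_deriv_def vector_4 sigma1_def sigma2_def sigma3_def sigma6_def
      by (auto intro!: derivative_eq_intros simp: algebra_simps)
    then show ?thesis ..
  qed
  then show ?thesis
    by (subst has_derivative_componentwise_within) (auto simp: Basis_vec_def inner_axis)
qed

lemma gradient_Gam:
  assumes "f differentiable at (Gam z)"
  shows "gradient (\<lambda>z. f (Gam z)) z = Gam_pullback z (gradient f (Gam z))"
proof -
  have "gradient (\<lambda>z. f (Gam z)) z \<bullet> v = Gam_pullback z (gradient f (Gam z)) \<bullet> v" for v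
    unfolding gradient_chain[OF Gam_has_derivative assms]
    by (simp add: Gam_deriv_def Gam_pullback_def inner_prod_def inner_vec3 inner_vec4 algebra_simps)
  then show ?thesis
    using vector_eq_rdot by blast
qed

text \<open>
  The map \<open>Gam\<close> is Poisson: the bracket of two invariants is the reduced bracket, evaluated at
  \<open>Gam\<close>. This pointwise identity yields the induced bracket, its well-definedness on \<open>Yvar\<close>, and
  the projection of Hamiltonian vector fields.
\<close>

lemma Gam_poisson:
  assumes "z \<in> Vvar"
  shows "Gam_deriv z (dirac_tensor z (Gam_pullback z e)) = reduced_tensor (Gam z) e"
proof -
  obtain x y where z: "z = (x, y)" by fastforce
  have V: "(x$1)^2 + (x$2)^2 - (x$3)^2 + 1 = 0" "x$1 * y$1 + x$2 * y$2 - x$3 * y$3 = 0"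
    using assms by (simp_all add: z mem_Vvar_iff)
  \<comment> \<open>The three inner products in the Dirac tensor, in terms of invariants; that of \<open>x\<close> with the second component uses \<open>lor x y = 0\<close>.\<close>
  define R where "R = x \<bullet> fst (Gam_pullback z e)"
  define Q where "Q = y \<bullet> snd (Gam_pullback z e)"
  have P: "x \<bullet> snd (Gam_pullback z e) = e$2 * x$3"
    using V(2) unfolding Gam_pullback_def z inner_vec3 fst_conv snd_conv vector_3 by algebra
  have R: "R = e$4 * sigma6 z + e$1 * x$3"
    unfolding R_def Gam_pullback_def z inner_vec3 fst_conv snd_conv vector_3 sigma6_def
    by algebra
  have Q: "Q = e$2 * y$3 + 2 * e$3 * sigma3 z + e$4 * sigma6 z"
    unfolding Q_def Gam_pullback_def z inner_vec3 fst_conv snd_conv vector_3 sigma6_def sigma3_def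
    by algebra
  have D: "dirac_tensor z (Gam_pullback z e) =
      (lflip (snd (Gam_pullback z e)) + (e$2 * x$3) *\<^sub>R x,
       - lflip (fst (Gam_pullback z e)) + (Q - R) *\<^sub>R x - (e$2 * x$3) *\<^sub>R y)"
    unfolding dirac_tensor_def P[symmetric] Q_def R_def by (simp add: z algebra_simps)
  note defs = Gam_deriv_def reduced_tensor_def Gam_pullback_def lflip_def sigma1_def sigma2_def
    vector_4 vector_3 Gam_nth fst_conv snd_conv vector_add_component vector_minus_component
    vector_uminus_component vector_scaleR_component real_scaleR_def
  show ?thesis
    unfolding vec4_eq_iff
  proof (intro conjI)
    show "Gam_deriv z (dirac_tensor z (Gam_pullback z e)) $ 1 = reduced_tensor (Gam z) e $ 1"
      unfolding D unfolding defs unfolding z defs by algebra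
    show "Gam_deriv z (dirac_tensor z (Gam_pullback z e)) $ 2 = reduced_tensor (Gam z) e $ 2"
      unfolding D Q R unfolding defs unfolding z defs by algebra
    have "(Q - R) * (x$1 * y$1 + x$2 * y$2 - x$3 * y$3) = 0"
      using V(2) by simp
    then show "Gam_deriv z (dirac_tensor z (Gam_pullback z e)) $ 3 = reduced_tensor (Gam z) e $ 3"
      unfolding D unfolding defs unfolding z defs sigma3_def by algebra
    show "Gam_deriv z (dirac_tensor z (Gam_pullback z e)) $ 4 = reduced_tensor (Gam z) e $ 4"
      unfolding D unfolding defs unfolding z defs by algebra
  qed
qed

lemma rpf_Gam:
  assumes "real_polynomial_function f"
  shows "real_polynomial_function (\<lambda>z. f (Gam z))"
proof -
  have "real_polynomial_function (\<lambda>z. Gam z \<bullet> i)" for i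
  proof -
    have c: "real_polynomial_function (\<lambda>z::(real^3) \<times> (real^3). fst z $ i)"
      "real_polynomial_function (\<lambda>z::(real^3) \<times> (real^3). snd z $ i)" for i
      using rpf_fst_snd(1)[of "axis i 1 :: real^3"] rpf_fst_snd(2)[of "axis i 1 :: real^3"]
      by (simp_all add: inner_axis)
    show ?thesis
      unfolding inner_vec4 Gam_nth sigma1_def sigma2_def sigma3_def sigma6_def
      by (intro real_polynomial_function.intros(2-4) real_polynomial_function_diff
          real_polynomial_function_power c)
  qed
  then have "polynomial_function Gam"
    by (simp add: polynomial_function_iff_Basis_inner)
  from real_polynomial_function_compose[OF this assms]
  show ?thesis by (simp add: o_def)
qed

section \<open>The image of the map of invariants\<close>

lemma Gam_Vvar_subset: "Gam ` Vvar \<subseteq> Yvar"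
proof clarify
  fix x y assume "(x, y) \<in> Vvar"
  then have V: "(x$1)^2 + (x$2)^2 - (x$3)^2 + 1 = 0" "x$1 * y$1 + x$2 * y$2 - x$3 * y$3 = 0"
    by (simp_all add: mem_Vvar_iff)
  show "Gam (x, y) \<in> Yvar"
    unfolding Yvar_def mem_Collect_eq Gam_nth sigma1_def sigma2_def sigma3_def sigma6_def
      fst_conv snd_conv
    using V by algebra
qed

text \<open>
  A rotation moves \<open>x\<close> to \<open>(r, 0, w\<^sub>1)\<close> with \<open>r\<^sup>2 = w\<^sub>1\<^sup>2 - 1\<close>. Then \<open>lor x y = 0\<close> and \<open>\<sigma>\<^sub>6 = r y\<^sub>2\<close> force the
  remaining components of \<open>y\<close>, and the equation of \<open>Yvar\<close> says that \<open>\<sigma>\<^sub>3\<close> takes the value \<open>w\<^sub>3\<close>.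
\<close>

lemma section_over_Yvar:
  assumes w: "w \<in> Yvar" and "w$1 > 1"
  shows "\<exists>z\<in>TH2. Gam z = w"
proof -
  define r where "r = sqrt ((w$1)\<^sup>2 - 1)"
  have "(w$1)\<^sup>2 > 1" using \<open>w$1 > 1\<close> by simp
  then have r: "r \<noteq> 0" "r\<^sup>2 = (w$1)\<^sup>2 - 1"
    by (simp_all add: r_def)
  let ?z = "(vector [r, 0, w$1], vector [w$1 * w$2 / r, w$4 / r, w$2]) :: (real^3) \<times> (real^3)"
  have "?z \<in> TH2"
    using r \<open>w$1 > 1\<close> by (simp add: TH2_def mem_Vvar_iff)
  moreover have "(w$1 * w$2 / r)\<^sup>2 + (w$4 / r)\<^sup>2 - (w$2)\<^sup>2 = w$3"
  proof -
    have "(w$1 * w$2 / r)\<^sup>2 + (w$4 / r)\<^sup>2 - (w$2)\<^sup>2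
        = ((w$1)\<^sup>2 * (w$2)\<^sup>2 + (w$4)\<^sup>2 - (w$2)\<^sup>2 * r\<^sup>2) / r\<^sup>2"
      using r(1) by (simp add: power_divide power_mult_distrib field_simps)
    also have "(w$1)\<^sup>2 * (w$2)\<^sup>2 + (w$4)\<^sup>2 - (w$2)\<^sup>2 * r\<^sup>2 = r\<^sup>2 * w$3"
      using w unfolding r(2) Yvar_def mem_Collect_eq by algebra
    finally show ?thesis using r(1) by simp
  qed
  then have "Gam ?z = w"
    using r(1) by (simp add: vec4_eq_iff sigma1_def sigma2_def sigma3_def sigma6_def)
  ultimately show ?thesis by blast
qed

lemma TH2_subset_Vvar: "TH2 \<subseteq> Vvar"
  by (auto simp: TH2_def)

text \<open>
  For a point of the image, \<open>w\<^sub>2\<^sup>2 + w\<^sub>3 = y\<^sub>1\<^sup>2 + y\<^sub>2\<^sup>2\<close>. The two rays arise from \<open>x = (0, 0, 1)\<close> and from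
  \<open>y = 0\<close>, respectively.
\<close>

lemma Gam_TH2_eq:
  "Gam ` TH2 = {w \<in> Yvar. w$1 > 1 \<and> (w$2)^2 + w$3 > 0} \<union>
    ({vector [1, 0, w3, 0] | w3. w3 \<ge> 0} \<union> {vector [w1, 0, 0, 0] | w1. w1 \<ge> 1})"
  (is "_ = ?R")
proof (intro equalityI subsetI)
  fix w assume "w \<in> Gam ` TH2"
  then obtain x y where xy: "(x, y) \<in> TH2" and w: "w = Gam (x, y)" by auto
  have V: "(x, y) \<in> Vvar" and "x$3 > 0"
    using xy by (auto simp: TH2_def)
  then have V': "(x$1)^2 + (x$2)^2 = (x$3)^2 - 1" "x$1 * y$1 + x$2 * y$2 = x$3 * y$3"
    by (simp_all add: mem_Vvar_iff)
  have "(x$3)\<^sup>2 \<ge> 1"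
    using V'(1) by (smt (verit) zero_le_power2)
  then have "x$3 \<ge> 1"
    using \<open>x$3 > 0\<close> by (smt (verit) power_le_one power2_eq_1_iff)
  have s: "(w$2)\<^sup>2 + w$3 = (y$1)\<^sup>2 + (y$2)\<^sup>2"
    by (simp add: w sigma2_def sigma3_def)
  show "w \<in> ?R"
  proof (cases "x$3 = 1")
    case True
    then have 0: "x$1 = 0" "x$2 = 0" using V'(1) by (simp_all add: sum_power2_eq_zero_iff)
    then have "y$3 = 0" using V'(2) True by simp
    then have "w = vector [1, 0, (y$1)\<^sup>2 + (y$2)\<^sup>2, 0]"
      using 0 True by (simp add: w vec4_eq_iff sigma1_def sigma2_def sigma3_def sigma6_def)
    then show ?thesis
      by (metis (mono_tags, lifting) UnI1 UnI2 mem_Collect_eq sum_power2_ge_zero)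
  next
    case False
    with \<open>x$3 \<ge> 1\<close> have "w$1 > 1" by (simp add: w sigma1_def)
    show ?thesis
    proof (cases "(w$2)\<^sup>2 + w$3 > 0")
      case True
      then show ?thesis using Gam_Vvar_subset V w \<open>w$1 > 1\<close> by auto
    next
      case False
      then have "(y$1)\<^sup>2 + (y$2)\<^sup>2 \<le> 0" using s by simp
      then have 0: "y$1 = 0" "y$2 = 0" by (simp_all add: sum_power2_le_zero_iff)
      then have "y$3 = 0" using V'(2) \<open>x$3 > 0\<close> by simp
      then have "w = vector [w$1, 0, 0, 0]"
        using 0 by (simp add: w vec4_eq_iff sigma1_def sigma2_def sigma3_def sigma6_def)
      then show ?thesis
        using \<open>w$1 > 1\<close> by (metis (mono_tags, lifting) UnI2 mem_Collect_eq less_imp_le)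
    qed
  qed
next
  fix w assume "w \<in> ?R"
  then consider "w \<in> Yvar" "w$1 > 1" | w3 where "w = vector [1, 0, w3, 0]" "w3 \<ge> 0"
    | w1 where "w = vector [w1, 0, 0, 0]" "w1 \<ge> 1"
    by blast
  then show "w \<in> Gam ` TH2"
  proof cases
    case 1
    then show ?thesis using section_over_Yvar by blast
  next
    case 2
    let ?z = "(vector [0, 0, 1], vector [sqrt w3, 0, 0]) :: (real^3) \<times> (real^3)"
    have "?z \<in> TH2" by (simp add: TH2_def mem_Vvar_iff)
    moreover have "Gam ?z = w"
      using 2 by (simp add: vec4_eq_iff sigma1_def sigma2_def sigma3_def sigma6_def)
    ultimately show ?thesis by blast
  next
    case 3
    let ?z = "(vector [sqrt (w1\<^sup>2 - 1), 0, w1], 0) :: (real^3) \<times> (real^3)"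
    have "w1\<^sup>2 \<ge> 1" using 3 by simp
    then have "?z \<in> TH2" using 3 by (simp add: TH2_def mem_Vvar_iff)
    moreover have "Gam ?z = w"
      using 3 by (simp add: vec4_eq_iff sigma1_def sigma2_def sigma3_def sigma6_def)
    ultimately show ?thesis by blast
  qed
qed

lemma rpf_eq_0_of_infinite_zeros:
  fixes p :: "real \<Rightarrow> real"
  assumes "real_polynomial_function p" and "infinite A" and "\<And>t. t \<in> A \<Longrightarrow> p t = 0"
  shows "p t = 0"
proof -
  obtain a n where p: "p = (\<lambda>x. \<Sum>i\<le>n. a i * x ^ i)"
    using assms(1) real_polynomial_function_imp_sum by blast
  have "infinite {x. (\<Sum>i\<le>n. a i * x ^ i) = 0}"
    using assms(2,3) unfolding p by (metis (mono_tags, lifting) finite_subset mem_Collect_eq subsetI)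
  then have "\<forall>i\<le>n. a i = 0"
    using polyfun_finite_roots[of a n] by blast
  then show ?thesis by (simp add: p)
qed

lemma rpf_on_curve_eq_0:
  fixes f :: "real^4 \<Rightarrow> real"
  assumes f: "real_polynomial_function f"
    and r: "real_polynomial_function a" "real_polynomial_function b"
      "real_polynomial_function c" "real_polynomial_function d"
    and "infinite A" "\<And>t::real. t \<in> A \<Longrightarrow> f (vector [a t, b t, c t, d t]) = 0"
  shows "f (vector [a t, b t, c t, d t]) = 0"
proof (rule rpf_eq_0_of_infinite_zeros[of "\<lambda>t. f (vector [a t, b t, c t, d t])", OF _ assms(6,7)])
  have "polynomial_function (\<lambda>t. vector [a t, b t, c t, d t] :: real^4)"
    unfolding polynomial_function_iff_Basis_inner inner_vec4 vector_4
    by (intro ballI real_polynomial_function.intros(2-4) r)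
  from real_polynomial_function_compose[OF this f]
  show "real_polynomial_function (\<lambda>t. f (vector [a t, b t, c t, d t]))"
    by (simp add: o_def)
qed

text \<open>
  Every point of \<open>Yvar\<close> lies on a polynomial curve inside \<open>Yvar\<close> that spends an infinite parameter set in
  the image of \<open>Gam\<close>, and a polynomial in one variable with infinitely many zeros is zero. If
  \<open>w\<^sub>1\<^sup>2 \<noteq> 1\<close>, the curve is parameterized by \<open>w\<^sub>1\<close>: letting \<open>w\<^sub>2\<close> and \<open>w\<^sub>4\<close> be proportional to \<open>w\<^sub>1\<^sup>2 - 1\<close> makes
  \<open>w\<^sub>3 = (w\<^sub>2\<^sup>2 + w\<^sub>4\<^sup>2) / (w\<^sub>1\<^sup>2 - 1)\<close> polynomial. If \<open>w\<^sub>1\<^sup>2 = 1\<close>, then \<open>w\<^sub>2 = w\<^sub>4 = 0\<close> and the curve is the line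
  in direction \<open>w\<^sub>3\<close>, which lies in the image for \<open>w\<^sub>3 \<ge> 0\<close>.
\<close>

lemma vanish_on_Yvar:
  assumes f: "real_polynomial_function f" and zero: "\<And>z. z \<in> Vvar \<Longrightarrow> f (Gam z) = 0"
    and w: "w \<in> Yvar"
  shows "f w = 0"
proof (cases "(w$1)\<^sup>2 = 1")
  case True
  have "(w$2)\<^sup>2 + (w$4)\<^sup>2 = 0"
    using w True by (simp add: Yvar_def)
  then have 0: "w$2 = 0" "w$4 = 0" by (simp_all add: sum_power2_eq_zero_iff)
  have "f (vector [w$1, 0, w$3, 0]) = 0"
  proof (rule rpf_on_curve_eq_0[OF f, where A = "{0..}" and t = "w$3"
        and a = "\<lambda>t. w$1" and b = "\<lambda>t. 0" and c = "\<lambda>t. t" and d = "\<lambda>t. 0"])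
    fix t :: real assume "t \<in> {0..}"
    let ?z = "(vector [0, 0, w$1], vector [sqrt t, 0, 0]) :: (real^3) \<times> (real^3)"
    have "?z \<in> Vvar" using True by (simp add: mem_Vvar_iff)
    moreover have "Gam ?z = vector [w$1, 0, t, 0]"
      using \<open>t \<in> {0..}\<close> by (simp add: vec4_eq_iff sigma1_def sigma2_def sigma3_def sigma6_def)
    ultimately show "f (vector [w$1, 0, t, 0]) = 0" using zero by metis
  qed (auto simp: infinite_Ici intro: real_polynomial_function.intros)
  moreover have "vector [w$1, 0, w$3, 0] = w" using 0 by (simp add: vec4_eq_iff)
  ultimately show ?thesis by simp
next
  case False
  define s where "s = (w$1)\<^sup>2 - 1"
  have s: "s \<noteq> 0" using False by (simp add: s_def)
  define a where "a = w$2 / s"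
  define d where "d = w$4 / s"
  have w3: "w$3 = (a\<^sup>2 + d\<^sup>2) * s"
  proof -
    have "w$3 * s = (w$2)\<^sup>2 + (w$4)\<^sup>2" using w by (simp add: Yvar_def s_def)
    then show ?thesis using s by (simp add: a_def d_def field_simps power2_eq_square)
  qed
  let ?c = "\<lambda>t::real. vector [t, a * (t\<^sup>2 - 1), (a\<^sup>2 + d\<^sup>2) * (t\<^sup>2 - 1), d * (t\<^sup>2 - 1)] :: real^4"
  have "f (?c (w$1)) = 0"
  proof (rule rpf_on_curve_eq_0[OF f, where A = "{1<..}" and t = "w$1"
        and a = "\<lambda>t. t" and b = "\<lambda>t. a * (t\<^sup>2 - 1)"
        and c = "\<lambda>t. (a\<^sup>2 + d\<^sup>2) * (t\<^sup>2 - 1)" and d = "\<lambda>t. d * (t\<^sup>2 - 1)"])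
    fix t :: real assume "t \<in> {1<..}"
    moreover have "?c t \<in> Yvar"
      unfolding Yvar_def mem_Collect_eq vector_4 by algebra
    ultimately obtain z where "z \<in> TH2" "Gam z = ?c t"
      using section_over_Yvar[of "?c t"] by auto
    then show "f (?c t) = 0" using zero TH2_subset_Vvar by (metis subsetD)
  qed (auto intro!: real_polynomial_function.intros(2-4) real_polynomial_function_diff
        real_polynomial_function_power real_polynomial_function.intros(1)[OF bounded_linear_ident]
        simp: infinite_Ioi)
  moreover have "?c (w$1) = w"
    using s w3 by (simp add: vec4_eq_iff a_def d_def s_def[symmetric])
  ultimately show ?thesis by simp
qed

lemma zariski_dense_Gam: "zariski_dense_in (Gam ` Vvar) Yvar"
proof -
  have "Yvar \<subseteq> C" if C: "zariski_closed C" "Gam ` Vvar \<subseteq> C" for C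
  proof -
    obtain P where P: "\<forall>p\<in>P. real_polynomial_function p" "C = {z. \<forall>p\<in>P. p z = 0}"
      using C(1) by (auto simp: zariski_closed_def)
    have "p w = 0" if "p \<in> P" "w \<in> Yvar" for p w
      by (rule vanish_on_Yvar) (use that P C(2) in auto)
    then show ?thesis by (auto simp: P(2))
  qed
  then show ?thesis
    using Gam_Vvar_subset by (simp add: zariski_dense_in_def)
qed

text \<open>
  The variety \<open>Yvar\<close> has singular points, so tangency is not shown by curves inside it. If \<open>f\<close> vanishes
  on \<open>Yvar\<close>, then \<open>f \<circ> Gam\<close> vanishes on \<open>Vvar\<close>; tangency there and the Poisson property of \<open>Gam\<close> show
  that the polynomial in question vanishes on the image of \<open>Gam\<close>, hence on \<open>Yvar\<close> by density.
\<close>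

lemma poisson_variety_reduced: "poisson_variety reduced_tensor Yvar"
proof (intro poisson_variety.intro poisson_variety_axioms.intro poisson_tensor_reduced)
  fix f :: "real^4 \<Rightarrow> real" and w v
  assume f: "real_polynomial_function f" and zero: "\<And>w. w \<in> Yvar \<Longrightarrow> f w = 0" and w: "w \<in> Yvar"
  interpret poisson_tensor reduced_tensor by (rule poisson_tensor_reduced)
  have "bracket f (\<lambda>w. w \<bullet> v) w = 0"
  proof (rule vanish_on_Yvar[OF rpf_bracket[OF f rpf_inner_const] _ w])
    fix z assume z: "z \<in> Vvar"
    have fz: "f (Gam z) = 0" if "z \<in> Vvar" for z
      using Gam_Vvar_subset zero that by blast
    have "bracket f (\<lambda>w. w \<bullet> v) (Gam z) = gradient f (Gam z) \<bullet> reduced_tensor (Gam z) v"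
      by (simp add: tensor_bracket_def)
    also have "\<dots> = gradient (\<lambda>z. f (Gam z)) z \<bullet> dirac_tensor z (Gam_pullback z v)"
      unfolding Gam_poisson[OF z, symmetric]
      by (rule gradient_chain[OF Gam_has_derivative, symmetric])
        (rule differentiable_at_real_polynomial_function[OF f])
    also have "\<dots> = 0"
      by (rule dirac.tangent[OF rpf_Gam[OF f] fz z])
    finally show "bracket f (\<lambda>w. w \<bullet> v) (Gam z) = 0" .
  qed
  then show "gradient f w \<bullet> reduced_tensor w v = 0"
    by (simp add: tensor_bracket_def)
qed

interpretation reduced: poisson_variety reduced_tensor Yvar
  by (rule poisson_variety_reduced)

section \<open>Orbits of elliptic rotations\<close>

lemma ell_rot_mult:
  "ell_rot \<theta> *v x = vector [cos \<theta> * x$1 - sin \<theta> * x$2, sin \<theta> * x$1 + cos \<theta> * x$2, x$3]"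
  by (simp add: vec3_eq_iff ell_rot_def matrix_vector_mult_def sum_3)

lemma orbit_of_G_e:
  "orbit_of G_e (x, y) = range (\<lambda>t.
     (vector [0, 0, x$3], vector [0, 0, y$3])
     + cos t *\<^sub>R (vector [x$1, x$2, 0], vector [y$1, y$2, 0])
     + sin t *\<^sub>R (vector [- x$2, x$1, 0], vector [- y$2, y$1, 0]))"
  (is "_ = range ?e")
proof -
  have act: "diag_act (ell_rot t) (x, y) = ?e t" for t
    by (simp add: diag_act_def ell_rot_mult vec3_eq_iff)
  have "?e t \<in> ?e ` {0..<2 * pi}" for t
  proof -
    obtain s where "0 \<le> s" "s < 2 * pi" "cos t = cos s" "sin t = sin s"
      using sincos_total_2pi[of "cos t" "sin t"] by auto
    then show ?thesis by (intro image_eqI[of _ _ s]) simp_all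
  qed
  then have "range ?e = ?e ` {0..<2 * pi}" by blast
  moreover have "orbit_of G_e (x, y) = (\<lambda>t. diag_act (ell_rot t) (x, y)) ` {0..<2 * pi}"
    by (auto simp: orbit_of_def G_e_def)
  ultimately show ?thesis
    by (simp only: act)
qed

lemma ellipse_subset_plane:
  fixes a b c :: "'a::euclidean_space"
  assumes "a \<noteq> 0" "b \<noteq> 0" "a \<bullet> b = 0"
  shows "\<exists>P. affine P \<and> aff_dim P = 2 \<and> range (\<lambda>t::real. c + cos t *\<^sub>R a + sin t *\<^sub>R b) \<subseteq> P"
proof (intro exI conjI)
  let ?P = "(+) c ` span {a, b}"
  have "a \<noteq> b" using assms by auto
  have "independent {a, b}"
    using assms by (intro pairwise_orthogonal_independent)
      (auto simp: pairwise_def orthogonal_def inner_commute)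
  then have "dim (span {a, b}) = 2"
    using \<open>a \<noteq> b\<close> by (simp add: dim_eq_card_independent)
  then show "aff_dim ?P = 2"
    by (simp add: aff_dim_translation_eq aff_dim_subspace)
  show "affine ?P"
    by (intro affine_translation[THEN iffD1] subspace_imp_affine subspace_span)
  show "range (\<lambda>t::real. c + cos t *\<^sub>R a + sin t *\<^sub>R b) \<subseteq> ?P"
  proof clarify
    fix t :: real
    have "cos t *\<^sub>R a + sin t *\<^sub>R b \<in> span {a, b}"
      by (intro span_add span_mul span_base) auto
    then show "c + cos t *\<^sub>R a + sin t *\<^sub>R b \<in> ?P"
      unfolding add.assoc by (rule imageI)
  qed
qed

lemma orbit_ellipse:
  assumes z: "z \<in> TH2" and "z \<noteq> (vector [0, 0, 1], vector [0, 0, 0])"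
  shows "is_ellipse (orbit_of G_e z) \<and>
    (\<exists>P. affine P \<and> aff_dim P = 2 \<and> orbit_of G_e z \<subseteq> P)"
proof -
  obtain x y where xy: "z = (x, y)" by fastforce
  have V: "(x$1)^2 + (x$2)^2 - (x$3)^2 + 1 = 0" "x$1 * y$1 + x$2 * y$2 - x$3 * y$3 = 0" "x$3 > 0"
    using z by (simp_all add: xy TH2_def mem_Vvar_iff)
  let ?a = "(vector [x$1, x$2, 0], vector [y$1, y$2, 0]) :: (real^3) \<times> (real^3)"
  let ?b = "(vector [- x$2, x$1, 0], vector [- y$2, y$1, 0]) :: (real^3) \<times> (real^3)"
  have "\<not> (x$1 = 0 \<and> x$2 = 0 \<and> y$1 = 0 \<and> y$2 = 0)"
  proof
    assume 0: "x$1 = 0 \<and> x$2 = 0 \<and> y$1 = 0 \<and> y$2 = 0"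
    then have "(x$3)\<^sup>2 = 1" "y$3 = 0" using V by simp_all
    with \<open>x$3 > 0\<close> have "x$3 = 1" by (simp add: power2_eq_1_iff)
    with 0 \<open>y$3 = 0\<close> assms(2) show False by (simp add: xy vec3_eq_iff)
  qed
  then have nz: "?a \<noteq> 0" "?b \<noteq> 0"
    by (auto simp: zero_prod_def vec3_eq_iff)
  have orth: "?a \<bullet> ?b = 0"
    by (simp add: inner_prod_def inner_vec3)
  show ?thesis
    unfolding xy orbit_of_G_e
    using nz orth ellipse_subset_plane[OF nz orth] unfolding is_ellipse_def by blast
qed

lemma orbit_vertex:
  "orbit_of G_e (vector [0, 0, 1], vector [0, 0, 0]) = {(vector [0, 0, 1], vector [0, 0, 0])}"
proof -
  have 0: "vector [0, 0, 0] = (0 :: real^3)" by (simp add: vec3_eq_iff)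
  show ?thesis
    unfolding orbit_of_G_e by (simp add: 0 zero_prod_def[symmetric])
qed

section \<open>Existence and uniqueness of the two brackets\<close>

lemma fst_nth_eq_inner:
  fixes z :: "(real^'n) \<times> 'b::euclidean_space"
  shows "fst z $ i = z \<bullet> (axis i 1, 0)"
  by (simp add: inner_prod_def inner_axis)

lemma snd_nth_eq_inner:
  fixes z :: "'a::euclidean_space \<times> (real^'n)"
  shows "snd z $ i = z \<bullet> (0, axis i 1)"
  by (simp add: inner_prod_def inner_axis)

lemma gmat_eq: "axis i 1 \<bullet> lflip (axis j 1) = gmat i j"
proof -
  have "\<forall>i j. lflip (axis j 1) $ i = gmat i j"
    unfolding forall_3 by (simp add: lflip_def gmat_def axis_def)
  then show ?thesis by (simp add: inner_axis')
qed

lemma is_dirac_induced: "is_dirac_poisson_bracket dirac.induced"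
proof -
  have coord: "(\<lambda>z\<in>Vvar. fst z $ i) = (\<lambda>z\<in>Vvar. z \<bullet> (axis i 1, 0))"
    "(\<lambda>z\<in>Vvar. snd z $ i) = (\<lambda>z\<in>Vvar. z \<bullet> (0, axis i 1))" for i
    by (simp_all only: fst_nth_eq_inner snd_nth_eq_inner)
  have "lflip 0 = 0" by (simp add: lflip_def vec3_eq_iff)
  then show ?thesis
    unfolding is_dirac_poisson_bracket_def coord dirac.induced_coordinates
    by (auto intro!: dirac.poisson_bracket_on_induced restrict_ext
        simp: inner_dirac_tensor gmat_eq inner_axis mult.commute)
qed

lemma is_dirac_unique:
  assumes B: "is_dirac_poisson_bracket B" and C: "is_dirac_poisson_bracket C"
  shows "B = C"
proof (rule poisson_bracket_on_eqI)
  note PB = B[unfolded is_dirac_poisson_bracket_def, THEN conjunct1]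
  note PC = C[unfolded is_dirac_poisson_bracket_def, THEN conjunct1]
  show "poisson_bracket_on Vvar B" by (rule PB)
  show "poisson_bracket_on Vvar C" by (rule PC)
  note RB = B[unfolded is_dirac_poisson_bracket_def fst_nth_eq_inner snd_nth_eq_inner, THEN conjunct2]
  note RC = C[unfolded is_dirac_poisson_bracket_def fst_nth_eq_inner snd_nth_eq_inner, THEN conjunct2]
  note r = rpf_inner_const
  fix i j z :: "(real^3) \<times> (real^3)"
  assume i: "i \<in> Basis" and j: "j \<in> Basis" and z: "z \<in> Vvar"
  have basis: "(\<exists>l. k = (axis l 1, 0)) \<or> (\<exists>l. k = (0, axis l 1))"
    if "k \<in> Basis" for k :: "(real^3) \<times> (real^3)"
    using that by (auto simp: Basis_prod_def Basis_vec_def)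
  show "B (\<lambda>z\<in>Vvar. z \<bullet> i) (\<lambda>z\<in>Vvar. z \<bullet> j) z = C (\<lambda>z\<in>Vvar. z \<bullet> i) (\<lambda>z\<in>Vvar. z \<bullet> j) z"
    using basis[OF i] basis[OF j]
  proof (elim disjE exE)
    fix l m assume "i = (0, axis l 1)" "j = (axis m 1, 0)"
    then have "B (\<lambda>z\<in>Vvar. z \<bullet> j) (\<lambda>z\<in>Vvar. z \<bullet> i) = C (\<lambda>z\<in>Vvar. z \<bullet> j) (\<lambda>z\<in>Vvar. z \<bullet> i)"
      by (simp only: RB RC)
    then show ?thesis
      using poisson_bracket_on_rpf(1)[OF PB r[of i] r[of i] r[of j] z]
        poisson_bracket_on_rpf(1)[OF PC r[of i] r[of i] r[of j] z] by (simp only:)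
  qed (simp only: RB RC)+
qed

lemma dirac_poisson_bracket_eq: "dirac_poisson_bracket = dirac.induced"
  unfolding dirac_poisson_bracket_def
  by (rule the_equality) (auto intro: is_dirac_induced is_dirac_unique)

lemma nth_eq_inner: "w $ i = w \<bullet> axis i 1" for w :: "real^'n"
  by (simp add: inner_axis)

lemma reduced_relations_induced: "reduced_relations reduced.induced"
proof -
  have "reduced.induced (\<lambda>w\<in>Yvar. w $ i) (\<lambda>w\<in>Yvar. w $ j)
      = (\<lambda>w\<in>Yvar. reduced_tensor w (axis j 1) $ i)" for i j
    unfolding nth_eq_inner[of _ i] nth_eq_inner[of _ j] reduced.induced_coordinates
    by (simp add: inner_axis inner_commute)
  then show ?thesis
    unfolding reduced_relations_def
    by (auto intro!: restrict_ext simp: reduced_tensor_def axis_def)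
qed

text \<open>
  The prescribed relations cover each pair of distinct coordinates in one of the two orders.
\<close>

lemma reduced_relations_unique:
  assumes B: "poisson_bracket_on Yvar B" "reduced_relations B"
    and C: "poisson_bracket_on Yvar C" "reduced_relations C"
  shows "B = C"
proof (rule poisson_bracket_on_eqI[OF B(1) C(1)])
  let ?x = "\<lambda>k::4. \<lambda>w\<in>Yvar. w $ k"
  fix i j w :: "real^4"
  assume "i \<in> Basis" "j \<in> Basis" and w: "w \<in> Yvar"
  then obtain k l where kl: "i = axis k 1" "j = axis l 1"
    by (auto simp: Basis_vec_def)
  have skewB: "B (?x k) (?x l) w = - B (?x l) (?x k) w" for k l
    by (rule poisson_bracket_on_rpf(1)[OF B(1) rpf_vec_nth rpf_vec_nth rpf_vec_nth w])
  have skewC: "C (?x k) (?x l) w = - C (?x l) (?x k) w" for k l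
    by (rule poisson_bracket_on_rpf(1)[OF C(1) rpf_vec_nth rpf_vec_nth rpf_vec_nth w])
  have diag: "B (?x k) (?x k) w = 0" "C (?x k) (?x k) w = 0" for k
    using skewB[of k k] skewC[of k k] by simp_all
  have eq: "B (?x 1) (?x 2) w = C (?x 1) (?x 2) w" "B (?x 2) (?x 3) w = C (?x 2) (?x 3) w"
      "B (?x 3) (?x 1) w = C (?x 3) (?x 1) w" "B (?x 1) (?x 4) w = C (?x 1) (?x 4) w"
      "B (?x 2) (?x 4) w = C (?x 2) (?x 4) w" "B (?x 3) (?x 4) w = C (?x 3) (?x 4) w"
    using B(2) C(2) unfolding reduced_relations_def by (simp_all del: restrict_apply)
  have "\<forall>k l. B (?x k) (?x l) w = C (?x k) (?x l) w"
    unfolding forall_4 using eq diag skewB[of 2 1] skewB[of 3 2] skewB[of 1 3] skewB[of 4]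
      skewC[of 2 1] skewC[of 3 2] skewC[of 1 3] skewC[of 4] by metis
  then show "B (\<lambda>w\<in>Yvar. w \<bullet> i) (\<lambda>w\<in>Yvar. w \<bullet> j) w = C (\<lambda>w\<in>Yvar. w \<bullet> i) (\<lambda>w\<in>Yvar. w \<bullet> j) w"
    unfolding kl nth_eq_inner[symmetric] by blast
qed

lemma bracket_Gam:
  assumes "f differentiable at (Gam z)" "g differentiable at (Gam z)" and z: "z \<in> Vvar"
  shows "dirac.bracket (\<lambda>z. f (Gam z)) (\<lambda>z. g (Gam z)) z = reduced.bracket f g (Gam z)"
  unfolding tensor_bracket_def gradient_Gam[OF assms(2)]
    gradient_chain[OF Gam_has_derivative assms(1)] Gam_poisson[OF z] by (rule refl)

lemma induces_bracket_Gam: "induces_bracket Vvar dirac.induced Gam Yvar reduced.induced"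
  unfolding induces_bracket_def
proof (intro conjI ballI reduced.poisson_bracket_on_induced)
  fix \<phi> \<psi> assume "\<phi> \<in> coord_ring Yvar" "\<psi> \<in> coord_ring Yvar"
  then obtain f g where f: "real_polynomial_function f" "\<phi> = restrict f Yvar"
      and g: "real_polynomial_function g" "\<psi> = restrict g Yvar"
    by (auto simp: coord_ring_def)
  have compose: "compose Vvar (restrict k Yvar) Gam = (\<lambda>z\<in>Vvar. k (Gam z))" for k :: "real^4 \<Rightarrow> real"
    unfolding compose_def using Gam_Vvar_subset by (intro restrict_ext) auto
  show "dirac.induced (compose Vvar \<phi> Gam) (compose Vvar \<psi> Gam)
      = compose Vvar (reduced.induced \<phi> \<psi>) Gam"
    unfolding f(2) g(2) reduced.induced_restrict[OF f(1) g(1)] compose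
      dirac.induced_restrict[OF rpf_Gam[OF f(1)] rpf_Gam[OF g(1)]]
    by (rule restrict_ext, rule bracket_Gam)
      (rule differentiable_at_real_polynomial_function, rule f g)+
qed

section \<open>Reduction of the equations of motion\<close>

text \<open>
  The Poisson property says that \<open>Gam_deriv\<close> takes the Hamiltonian vector of \<open>h \<circ> Gam\<close> to that of \<open>h\<close>.
\<close>

lemma solution_on_Gam:
  assumes "D \<subseteq> Vvar" "Gam ` D \<subseteq> D'" "D' \<subseteq> Yvar" "\<And>z. z \<in> D \<Longrightarrow> h differentiable at (Gam z)"
    and F: "\<And>z. z \<in> D \<Longrightarrow> F z = hamiltonian_field Vvar dirac.induced (\<lambda>z. h (Gam z)) z"
    and sol: "solution_on F D I c"
  shows "solution_on (hamiltonian_field Yvar reduced.induced h) D' I (Gam \<circ> c)"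
  unfolding solution_on_def
proof (intro conjI ballI)
  show "open I" "is_interval I" using sol by (auto simp: solution_on_def)
  fix t assume "t \<in> I"
  then have ct: "c t \<in> D" and dc: "(c has_vector_derivative F (c t)) (at t)"
    using sol by (auto simp: solution_on_def)
  then have V: "c t \<in> Vvar" and Y: "Gam (c t) \<in> Yvar"
    using assms(1-3) by blast+
  show "(Gam \<circ> c) t \<in> D'" using ct assms(2) by auto
  have "hamiltonian_field Yvar reduced.induced h (Gam (c t)) = Gam_deriv (c t) (F (c t))"
    by (simp add: F[OF ct] reduced.hamiltonian_field_induced[OF Y]
        dirac.hamiltonian_field_induced[OF V] gradient_Gam[OF assms(4)[OF ct]] Gam_poisson[OF V])
  moreover have "((\<lambda>t. Gam (c t)) has_vector_derivative Gam_deriv (c t) (F (c t))) (at t)"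
    using vector_derivative_diff_chain_within[OF dc, of Gam "Gam_deriv (c t)"]
      has_derivative_at_withinI[OF Gam_has_derivative] by (simp add: o_def)
  ultimately show "((Gam \<circ> c) has_vector_derivative
      hamiltonian_field Yvar reduced.induced h ((Gam \<circ> c) t)) (at t)"
    by (simp add: o_def)
qed

lemma DERIV_compose_vec_nth:
  fixes w :: "real^'n"
  assumes "(U has_real_derivative U') (at (w$i))"
  shows "((\<lambda>w. U (w$i)) has_derivative (\<lambda>v. v$i * U')) (at w)"
  by (rule DERIV_compose_FDERIV[where g = "\<lambda>w. w$i", OF assms])
    (rule bounded_linear_imp_has_derivative[OF bounded_linear_vec_nth])

lemma energy_has_derivative:
  fixes w :: "real^4"
  assumes U: "(U has_real_derivative U') (at (w$1))"
  shows "((\<lambda>w. 1/2 * w$3 + U (w$1)) has_derivative (\<lambda>v. vector [U', 0, 1/2, 0] \<bullet> v)) (at w)"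
  by (auto intro!: derivative_eq_intros DERIV_compose_vec_nth[OF U] simp: inner_vec4)

lemma gradient_energy:
  fixes w :: "real^4"
  assumes U: "(U has_real_derivative U') (at (w$1))"
  shows "gradient (\<lambda>w. 1/2 * w$3 + U (w$1)) w = vector [U', 0, 1/2, 0]"
  by (rule gradient_eqI[OF energy_has_derivative[OF U]])

text \<open>
  The Hamiltonian is invariant, so its gradient is pulled back from the reduced space. On the variety
  its \<open>y\<close>-part is \<open>b = lflip y\<close>, so that \<open>x \<bullet> b = lor x y = 0\<close> removes the two terms of the Dirac tensor
  with this factor and \<open>y \<bullet> b = lor y y\<close>.
\<close>

lemma motion_field_eq_hamiltonian_field:
  assumes U: "(U has_real_derivative U') (at (sigma1 z))" and z: "z \<in> Vvar"
  shows "motion_field (\<lambda>x. U (x$3)) z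
    = hamiltonian_field Vvar dirac.induced (\<lambda>z. 1/2 * sigma3 z + U (sigma1 z)) z"
proof -
  obtain x y where xy: "z = (x, y)" by fastforce
  let ?h = "\<lambda>w::real^4. 1/2 * w$3 + U (w$1)"
  have U4: "(U has_real_derivative U') (at (Gam z $ 1))" using U by simp
  have "gradient (\<lambda>z. 1/2 * sigma3 z + U (sigma1 z)) z = gradient (\<lambda>z. ?h (Gam z)) z"
    by simp
  also have "\<dots> = Gam_pullback z (gradient ?h (Gam z))"
    by (rule gradient_Gam) (rule differentiableI[OF energy_has_derivative[OF U4]])
  also have "\<dots> = (vector [0, 0, U'], lflip y)"
    unfolding gradient_energy[OF U4] by (simp add: Gam_pullback_def xy lflip_def)
  finally have grad: "gradient (\<lambda>z. 1/2 * sigma3 z + U (sigma1 z)) z = (vector [0, 0, U'], lflip y)" .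
  have "((\<lambda>x. U (x$3)) has_derivative (\<lambda>v. v$3 * U')) (at x)"
    using U by (intro DERIV_compose_vec_nth) (simp add: xy sigma1_def)
  then have "frechet_derivative (\<lambda>x. U (x$3)) (at x) = (\<lambda>v. v$3 * U')"
    by (metis frechet_derivative_at)
  then have nabla: "nabla_lor (\<lambda>x. U (x$3)) x = vector [0, 0, - U']"
    by (simp add: nabla_lor_def partial_at_def axis_def)
  have xy0: "x \<bullet> lflip y = 0" using z by (simp add: xy mem_Vvar_iff lflip_def inner_vec3)
  have yy: "y \<bullet> lflip y = lor y y" by (simp add: lor_def lflip_def inner_vec3)
  have ll: "lflip (lflip y) = y" by (simp add: lflip_def vec3_eq_iff)
  have xU: "x \<bullet> vector [0, 0, U'] = x$3 * U'" "lor x (vector [0, 0, - U']) = x$3 * U'"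
    by (simp_all add: inner_vec3 lor_def)
  show ?thesis
    unfolding dirac.hamiltonian_field_induced[OF z] grad
    by (simp add: motion_field_def dirac_tensor_def xy nabla xy0 yy ll xU)
      (simp add: vec3_eq_iff lflip_def algebra_simps)
qed

lemma rational_has_derivative:
  fixes p q :: "real poly"
  assumes "poly q s \<noteq> 0"
  shows "((\<lambda>s. poly p s / poly q s) has_real_derivative deriv (\<lambda>s. poly p s / poly q s) s) (at s)"
proof -
  have "(\<lambda>s. poly p s / poly q s) field_differentiable (at s)"
    using assms by (intro field_differentiable_divide)
      (auto simp: field_differentiable_def intro: poly_DERIV)
  then show ?thesis by (simp add: DERIV_deriv_iff_field_differentiable)
qed

theorem proposition3p4:
  shows
    "(let z0 = (vector [0, 0, 1], vector [0, 0, 0]) :: (real^3) \<times> (real^3) in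
        orbit_of G_e z0 = {z0} \<and>
        (\<forall>z \<in> TH2 - {z0}. is_ellipse (orbit_of G_e z) \<and>
           (\<exists>P. affine P \<and> aff_dim P = 2 \<and> orbit_of G_e z \<subseteq> P))) \<and>
    Gam ` Vvar \<subseteq> Yvar \<and>
    Gam ` TH2 = {w \<in> Yvar. w$1 > 1 \<and> (w$2)^2 + w$3 > 0} \<union>
       ({vector [1, 0, w3, 0] | w3. w3 \<ge> 0} \<union> {vector [w1, 0, 0, 0] | w1. w1 \<ge> 1}) \<and>
    zariski_dense_in (Gam ` Vvar) Yvar \<and>
    is_dirac_poisson_bracket dirac_poisson_bracket \<and>
    (\<exists>B'. induces_bracket Vvar dirac_poisson_bracket Gam Yvar B' \<and>
       reduced_relations B' \<and>
       (\<forall>B''. poisson_bracket_on Yvar B'' \<and> reduced_relations B'' \<longrightarrow> B'' = B') \<and>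
       (\<forall>p q :: real poly. q \<noteq> 0 \<longrightarrow>
          (let U = (\<lambda>s. poly p s / poly q s);
               H = (\<lambda>z. 1/2 * sigma3 z + U (sigma1 z));
               h = (\<lambda>w::real^4. 1/2 * w$3 + U (w$1));
               M = motion_field (\<lambda>x. U (x$3));
               R = hamiltonian_field Yvar B' h;
               DV = {z \<in> TH2. poly q (sigma1 z) \<noteq> 0};
               DY = {w \<in> Yvar. poly q (w$1) \<noteq> 0}
           in (\<forall>z\<in>DV. M z = hamiltonian_field Vvar dirac_poisson_bracket H z) \<and>
              (\<forall>I z. solution_on M DV I z \<longrightarrow> solution_on R DY I (Gam \<circ> z)) \<and>
              (\<forall>w\<in>DY.
                 bracket_ext Yvar B' (\<lambda>w. w$1) h w = w$2 \<and>
                 bracket_ext Yvar B' (\<lambda>w. w$2) h w = w$1 * w$3 + (1 - (w$1)^2) * deriv U (w$1) \<and>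
                 bracket_ext Yvar B' (\<lambda>w. w$3) h w = - 2 * w$2 * deriv U (w$1) \<and>
                 bracket_ext Yvar B' (\<lambda>w. w$4) h w = 0) \<and>
              first_integral_on R DY h \<and>
              first_integral_on R DY (\<lambda>w. w$4))))"
  unfolding dirac_poisson_bracket_eq
proof (intro conjI exI[of _ reduced.induced])
  show "let z0 = (vector [0, 0, 1], vector [0, 0, 0]) :: (real^3) \<times> (real^3) in
      orbit_of G_e z0 = {z0} \<and>
      (\<forall>z \<in> TH2 - {z0}. is_ellipse (orbit_of G_e z) \<and>
         (\<exists>P. affine P \<and> aff_dim P = 2 \<and> orbit_of G_e z \<subseteq> P))"
    unfolding Let_def using orbit_vertex orbit_ellipse by blast
  show "\<forall>B''. poisson_bracket_on Yvar B'' \<and> reduced_relations B'' \<longrightarrow> B'' = reduced.induced"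
    using reduced_relations_unique reduced.poisson_bracket_on_induced reduced_relations_induced
    by blast
  show "\<forall>p q :: real poly. q \<noteq> 0 \<longrightarrow>
          (let U = (\<lambda>s. poly p s / poly q s);
               H = (\<lambda>z. 1/2 * sigma3 z + U (sigma1 z));
               h = (\<lambda>w::real^4. 1/2 * w$3 + U (w$1));
               M = motion_field (\<lambda>x. U (x$3));
               R = hamiltonian_field Yvar reduced.induced h;
               DV = {z \<in> TH2. poly q (sigma1 z) \<noteq> 0};
               DY = {w \<in> Yvar. poly q (w$1) \<noteq> 0}
           in (\<forall>z\<in>DV. M z = hamiltonian_field Vvar dirac.induced H z) \<and>
              (\<forall>I z. solution_on M DV I z \<longrightarrow> solution_on R DY I (Gam \<circ> z)) \<and>
              (\<forall>w\<in>DY.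
                 bracket_ext Yvar reduced.induced (\<lambda>w. w$1) h w = w$2 \<and>
                 bracket_ext Yvar reduced.induced (\<lambda>w. w$2) h w
                   = w$1 * w$3 + (1 - (w$1)^2) * deriv U (w$1) \<and>
                 bracket_ext Yvar reduced.induced (\<lambda>w. w$3) h w = - 2 * w$2 * deriv U (w$1) \<and>
                 bracket_ext Yvar reduced.induced (\<lambda>w. w$4) h w = 0) \<and>
              first_integral_on R DY h \<and>
              first_integral_on R DY (\<lambda>w. w$4))"
    (is "\<forall>p q. q \<noteq> 0 \<longrightarrow> ?P p q")
  proof (intro allI impI)
    fix p q :: "real poly"
    define U where "U = (\<lambda>s. poly p s / poly q s)"
    let ?h = "\<lambda>w::real^4. 1/2 * w$3 + U (w$1)"
    let ?H = "\<lambda>z. 1/2 * sigma3 z + U (sigma1 z)"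
    let ?DV = "{z \<in> TH2. poly q (sigma1 z) \<noteq> 0}"
    let ?DY = "{w \<in> Yvar. poly q (w$1) \<noteq> 0}"
    have U: "(U has_real_derivative deriv U s) (at s)" if "poly q s \<noteq> 0" for s
      unfolding U_def using that by (rule rational_has_derivative)
    have h: "?h differentiable at w" "gradient ?h w = vector [deriv U (w$1), 0, 1/2, 0]"
      if "w \<in> ?DY" for w
      using that differentiableI[OF energy_has_derivative[OF U]] gradient_energy[OF U] by auto
    have M1: "motion_field (\<lambda>x. U (x$3)) z = hamiltonian_field Vvar dirac.induced ?H z"
      if "z \<in> ?DV" for z
      using that TH2_subset_Vvar motion_field_eq_hamiltonian_field[OF U, of z] by auto
    then have M: "\<forall>z\<in>?DV. motion_field (\<lambda>x. U (x$3)) z = hamiltonian_field Vvar dirac.induced ?H z"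
      by blast
    have image: "Gam ` ?DV \<subseteq> ?DY"
      using Gam_Vvar_subset TH2_subset_Vvar by auto
    have solution: "\<forall>I c. solution_on (motion_field (\<lambda>x. U (x$3))) ?DV I c \<longrightarrow>
        solution_on (hamiltonian_field Yvar reduced.induced ?h) ?DY I (Gam \<circ> c)"
    proof (intro allI impI)
      fix I c assume "solution_on (motion_field (\<lambda>x. U (x$3))) ?DV I c"
      then show "solution_on (hamiltonian_field Yvar reduced.induced ?h) ?DY I (Gam \<circ> c)"
      proof (rule solution_on_Gam[OF _ image, rotated -1])
        show "?DV \<subseteq> Vvar" using TH2_subset_Vvar by blast
        show "?DY \<subseteq> Yvar" by blast
        fix z assume z: "z \<in> ?DV"
        show "?h differentiable at (Gam z)" using z image by (intro h(1)) blast
        show "motion_field (\<lambda>x. U (x$3)) z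
            = hamiltonian_field Vvar dirac.induced (\<lambda>z. ?h (Gam z)) z"
          unfolding Gam_nth using z by (rule M1)
      qed
    qed
    have field: "bracket_ext Yvar reduced.induced (\<lambda>w. w$i) ?h w
        = reduced_tensor w (vector [deriv U (w$1), 0, 1/2, 0]) $ i" if "w \<in> ?DY" for i w
      unfolding nth_eq_inner[of _ i]
      using that reduced.bracket_ext_induced[of w "axis i 1" ?h] h(2)[OF that]
      by (simp add: inner_axis inner_commute)
    have energy: "first_integral_on (hamiltonian_field Yvar reduced.induced ?h) ?DY ?h"
      by (rule reduced.energy_first_integral) (use h(1) in auto)
    have momentum: "first_integral_on (hamiltonian_field Yvar reduced.induced ?h) ?DY (\<lambda>w. w$4)"
      unfolding nth_eq_inner[of _ 4]
      by (rule reduced.first_integral_onI)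
        (auto simp: inner_axis' reduced_tensor_def
          intro!: differentiable_at_real_polynomial_function rpf_inner_const)
    have system: "\<forall>w\<in>?DY.
         bracket_ext Yvar reduced.induced (\<lambda>w. w$1) ?h w = w$2 \<and>
         bracket_ext Yvar reduced.induced (\<lambda>w. w$2) ?h w
           = w$1 * w$3 + (1 - (w$1)^2) * deriv U (w$1) \<and>
         bracket_ext Yvar reduced.induced (\<lambda>w. w$3) ?h w = - 2 * w$2 * deriv U (w$1) \<and>
         bracket_ext Yvar reduced.induced (\<lambda>w. w$4) ?h w = 0"
    proof (rule ballI)
      fix w assume "w \<in> ?DY"
      note field = field[OF this]
      show "bracket_ext Yvar reduced.induced (\<lambda>w. w$1) ?h w = w$2 \<and>
          bracket_ext Yvar reduced.induced (\<lambda>w. w$2) ?h w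
            = w$1 * w$3 + (1 - (w$1)^2) * deriv U (w$1) \<and>
          bracket_ext Yvar reduced.induced (\<lambda>w. w$3) ?h w = - 2 * w$2 * deriv U (w$1) \<and>
          bracket_ext Yvar reduced.induced (\<lambda>w. w$4) ?h w = 0"
        unfolding field by (simp add: reduced_tensor_def algebra_simps)
    qed
    show "?P p q"
      unfolding Let_def U_def[symmetric]
      by (intro conjI M solution system energy momentum)
  qed
qed (fact Gam_Vvar_subset Gam_TH2_eq zariski_dense_Gam is_dirac_induced induces_bracket_Gam
    reduced_relations_induced)+

end
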